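(* Let $\Omega\subset\mathbb{C}^n$ be a bounded convex domain and $\mathcal{S}\neq\varnothing$ a finite family of complex affine hyperplanes intersecting $\Omega$. Then $(\Omega\setminus\bigcup\mathcal{S},\,k_{\Omega\setminus\bigcup\mathcal{S}})$ is not Gromov hyperbolic.
   Context: A domain is a non-empty connected open set. Each hyperplane in the family $\mathcal{S}$ is a complex affine hyperplane of $\mathbb{C}^n$ that meets $\Omega$, and $\bigcup\mathcal{S}$ is the union of the hyperplanes in the family. Let $\mathbb{D}=\{\lambda\in\mathbb{C}:|\lambda|<1\}$. For a domain $G\subset\mathbb{C}^n$ the Kobayashi pseudometric is $\kappa_G(z;X)=\inf\{|\lambda|:\text{there is a holomorphic } f:\mathbb{D}\to G \text{ with } f(0)=z,\ \lambda f'(0)=X\}$ for $z\in G$, $X\in\mathbb{C}^n$. The Kobayashi pseudodistance is $k_G(p,q)=\inf_\alpha\int_0^1\kappa_G(\alpha(t);\alpha'(t))\,dt$, the infimum over all piecewise $\mathcal{C}^1$ curves $\alpha:[0,1]\to G$ with $\alpha(0)=p$, $\alpha(1)=q$. It is a distance if $G$ is bounded. In a metric space $(X,d)$ a curve $\alpha:[a,b]\to X$ is a geodesic if $d(\alpha(s),\alpha(t))=|s-t|$ for all $s,t\in[a,b]$. A geodesic triangle is a choice of three points together with geodesic segments connecting these points; it is $M$-thin if any point on any side is within distance $M$ of the other two sides. A geodesic metric space is Gromov hyperbolic if there is $M>0$ such that every geodesic triangle is $M$-thin.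
   Formalization: The condition n ≥ 2 is added: for n = 1 the hyperplanes are points and the claim fails, e.g. the unit disc minus the origin with its Kobayashi distance is Gromov hyperbolic. *)

theory Defs
  imports "HOL-Analysis.Analysis"
begin

definition complex_hyperplane :: "(complex ^ 'n) set \<Rightarrow> bool" where
  "complex_hyperplane H \<longleftrightarrow>
     (\<exists>a b. a \<noteq> 0 \<and> H = {z. (\<Sum>i\<in>UNIV. a $ i * z $ i) = b})"

definition holomorphic_disc :: "(complex ^ 'n) set \<Rightarrow> (complex \<Rightarrow> complex ^ 'n) \<Rightarrow> bool" where
  "holomorphic_disc G f \<longleftrightarrow>
     (\<forall>i. (\<lambda>\<zeta>. f \<zeta> $ i) holomorphic_on ball 0 1) \<and> f ` ball 0 1 \<subseteq> G"

(* For open G and z in G the set below is non-empty (use small affine discs), so the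
   real-valued infimum is the intended one. *)
definition kobayashi_metric :: "(complex ^ 'n) set \<Rightarrow> complex ^ 'n \<Rightarrow> complex ^ 'n \<Rightarrow> real" where
  "kobayashi_metric G z X =
     Inf {cmod l | l f. holomorphic_disc G f \<and> f 0 = z \<and>
                        l *s (\<chi> i. deriv (\<lambda>\<zeta>. f \<zeta> $ i) 0) = X}"

(* Each piece is C1 up to its end points (with one-sided derivatives there). The library's
   piecewise_C1_differentiable_on does not require this: it admits curves whose derivative
   is unbounded near a break point. *)
definition piecewise_C1_curve :: "(real \<Rightarrow> 'a::real_normed_vector) \<Rightarrow> bool" where
  "piecewise_C1_curve \<alpha> \<longleftrightarrow>
     (\<exists>(m::nat) s. s 0 = 0 \<and> s m = 1 \<and>
        (\<forall>j<m. s j < s (Suc j) \<and>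
           (\<exists>D. continuous_on {s j..s (Suc j)} D \<and>
              (\<forall>t\<in>{s j..s (Suc j)}.
                 (\<alpha> has_vector_derivative D t) (at t within {s j..s (Suc j)})))))"

(* The vector derivative is meaningful except at the finitely many break points, which do
   not affect the integral. The integral is taken in the extended non-negative reals; for
   a domain G the infimum is finite, so enn2real loses nothing. *)
definition kobayashi_dist :: "(complex ^ 'n) set \<Rightarrow> complex ^ 'n \<Rightarrow> complex ^ 'n \<Rightarrow> real" where
  "kobayashi_dist G p q =
     enn2real (INF \<alpha> \<in> {\<alpha>. piecewise_C1_curve \<alpha> \<and> \<alpha> ` {0..1} \<subseteq> G \<and> \<alpha> 0 = p \<and> \<alpha> 1 = q}.
       \<integral>\<^sup>+t\<in>{0..1}.
         ennreal (kobayashi_metric G (\<alpha> t) (vector_derivative \<alpha> (at t within {0..1}))) \<partial>lborel)"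

definition geodesic :: "'a set \<Rightarrow> ('a \<Rightarrow> 'a \<Rightarrow> real) \<Rightarrow> real \<Rightarrow> real \<Rightarrow> (real \<Rightarrow> 'a) \<Rightarrow> bool" where
  "geodesic X d a b \<alpha> \<longleftrightarrow>
     a \<le> b \<and> \<alpha> ` {a..b} \<subseteq> X \<and> (\<forall>s\<in>{a..b}. \<forall>t\<in>{a..b}. d (\<alpha> s) (\<alpha> t) = \<bar>s - t\<bar>)"

definition geodesic_segment :: "'a set \<Rightarrow> ('a \<Rightarrow> 'a \<Rightarrow> real) \<Rightarrow> 'a \<Rightarrow> 'a \<Rightarrow> 'a set \<Rightarrow> bool" where
  "geodesic_segment X d p q A \<longleftrightarrow>
     (\<exists>a b \<alpha>. geodesic X d a b \<alpha> \<and> \<alpha> a = p \<and> \<alpha> b = q \<and> A = \<alpha> ` {a..b})"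

definition geodesic_triangle ::
    "'a set \<Rightarrow> ('a \<Rightarrow> 'a \<Rightarrow> real) \<Rightarrow> 'a set \<Rightarrow> 'a set \<Rightarrow> 'a set \<Rightarrow> bool" where
  "geodesic_triangle X d A B C \<longleftrightarrow>
     (\<exists>x y z. geodesic_segment X d x y A \<and> geodesic_segment X d y z B \<and> geodesic_segment X d z x C)"

definition thin_triangle ::
    "('a \<Rightarrow> 'a \<Rightarrow> real) \<Rightarrow> real \<Rightarrow> 'a set \<Rightarrow> 'a set \<Rightarrow> 'a set \<Rightarrow> bool" where
  "thin_triangle d M A B C \<longleftrightarrow>
     (\<forall>p\<in>A. \<exists>q\<in>B \<union> C. d p q \<le> M) \<and>
     (\<forall>p\<in>B. \<exists>q\<in>C \<union> A. d p q \<le> M) \<and>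
     (\<forall>p\<in>C. \<exists>q\<in>A \<union> B. d p q \<le> M)"

(* The notion is meant for geodesic metric spaces. That requirement is deliberately not a
   conjunct, so that the negation always asserts the existence of fat geodesic triangles
   and cannot hold merely because (X, d) is not a geodesic space. *)
definition gromov_hyperbolic :: "'a set \<Rightarrow> ('a \<Rightarrow> 'a \<Rightarrow> real) \<Rightarrow> bool" where
  "gromov_hyperbolic X d \<longleftrightarrow>
     (\<exists>M>0. \<forall>A B C. geodesic_triangle X d A B C \<longrightarrow> thin_triangle d M A B C)"

end

theory Submission
  imports Defs "HOL-Complex_Analysis.Conformal_Mappings"
begin

text \<open>
  Put \<open>G = \<Omega> - \<Union>\<S>\<close> and let \<open>k\<close> be its Kobayashi distance. Near a hyperplane
  \<open>H = {\<ell> = 0}\<close> of the family the space looks like the product of a cusp, namely a punctured disc in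
  a direction transverse to \<open>H\<close>, with the unbounded space \<open>H \<inter> \<Omega>\<close>. A product of two unbounded spaces
  contains arbitrarily wide strips, hence is not Gromov hyperbolic. Three ingredients make this precise.

  \<^emph>\<open>Bounds for the distance.\<close> Upper bounds come from explicit holomorphic discs. Lower bounds come
  from positive pluriharmonic functions \<open>h\<close>: on a disc such an \<open>h\<close> is the real part of a map into the right
  half plane, so the lemma of Schwarz and Pick shows that \<open>ln h / 2\<close> is 1-Lipschitz for \<open>k\<close>
  (lemma \<open>ln_pos_pluriharmonic_le_dist\<close>). Two such functions suffice: the real part of a complex affine
  function that supports \<open>\<Omega>\<close> at a boundary point, and \<open>ln (R / \<bar>\<ell>\<bar>)\<close>.

  \<^emph>\<open>Geodesics.\<close> To refute hyperbolicity one has to exhibit geodesic triangles. The two functions above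
  tend to 0 or to infinity at the boundary of \<open>\<Omega>\<close> and at the hyperplanes, so closed balls of \<open>k\<close> are
  compact (lemma \<open>kobayashi_balls_compact\<close>). Curves of almost minimal length, reparametrised by length, are
  almost geodesics; a compactness argument in a product space turns them into a geodesic
  (lemma \<open>kobayashi_geodesic_exists\<close>).

  \<^emph>\<open>Wide strips.\<close> For \<open>x \<in> H \<inter> \<Omega>\<close> outside the other hyperplanes and \<open>v\<close> transverse to \<open>H\<close> the ray
  \<open>t \<mapsto> x + exp (- exp (2 * t)) v\<close> runs into the cusp with unit speed up to a bounded error: the upper
  bound is the Poincare metric of the punctured disc, and the lower bound is given by \<open>ln (R / \<bar>\<ell>\<bar>)\<close>.
  Two such rays that start from points \<open>x\<close>, \<open>x'\<close> of \<open>H\<close> stay at bounded distance at equal height, because the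
  segment from \<open>x\<close> to \<open>x'\<close> can be translated along \<open>v\<close>. If \<open>x'\<close> is close to a boundary point \<open>\<xi>\<close> of \<open>\<Omega>\<close>,
  then the supporting function at \<open>\<xi>\<close> keeps the two rays as far apart as desired
  (lemma \<open>wide_strips_in_convex_minus_hyperplanes\<close>). In a space with thin triangles a long strip bounded by
  two such rough geodesics has a width controlled by the thinness constant
  (lemma \<open>no_wide_strip\<close>), a contradiction.
\<close>

section \<open>The Kobayashi metric of an open set\<close>

abbreviation disc_tangent :: "(complex \<Rightarrow> complex ^ 'n) \<Rightarrow> complex ^ 'n" where
  "disc_tangent f \<equiv> (\<chi> i. deriv (\<lambda>\<zeta>. f \<zeta> $ i) 0)"

lemma norm_cscale: "norm (c *s (x :: complex ^ 'n)) = cmod c * norm x"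
  by (simp add: norm_vec_def L2_set_def norm_mult power_mult_distrib sum_distrib_left[symmetric] real_sqrt_mult)

lemma scaleR_eq_cscale: "r *\<^sub>R (x :: complex ^ 'n) = complex_of_real r *s x"
  unfolding vec_eq_iff vector_scaleR_component vector_smult_component
  by (simp add: scaleR_conv_of_real)

lemma has_vector_derivative_vecI:
  fixes f :: "real \<Rightarrow> complex ^ 'n"
  assumes "\<And>i. ((\<lambda>t. f t $ i) has_vector_derivative (D $ i)) (at x within S)"
  shows "(f has_vector_derivative D) (at x within S)"
  unfolding has_vector_derivative_def has_derivative_within
proof
  show "((\<lambda>y. (1 / norm (y - x)) *\<^sub>R (f y - (f x + (y - x) *\<^sub>R D))) \<longlongrightarrow> 0) (at x within S)"
  proof (rule vec_tendstoI)
    fix i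
    show "((\<lambda>y. ((1 / norm (y - x)) *\<^sub>R (f y - (f x + (y - x) *\<^sub>R D))) $ i) \<longlongrightarrow> 0 $ i) (at x within S)"
      using assms[of i] unfolding has_vector_derivative_def has_derivative_within by simp
  qed
qed (rule bounded_linear_scaleR_left)

lemma kobayashi_metric_le:
  assumes "holomorphic_disc G f" "f 0 = z" "l *s disc_tangent f = X"
  shows "kobayashi_metric G z X \<le> cmod l"
  unfolding kobayashi_metric_def
  by (rule cInf_lower) (use assms in \<open>auto intro!: bdd_belowI[where m=0]\<close>)

lemma holomorphic_disc_affine:
  assumes "\<And>\<zeta>. cmod \<zeta> < 1 \<Longrightarrow> z + \<zeta> *s Y \<in> G"
  shows "holomorphic_disc G (\<lambda>\<zeta>. z + \<zeta> *s Y)" "disc_tangent (\<lambda>\<zeta>. z + \<zeta> *s Y) = Y"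
proof -
  have "(\<lambda>\<zeta>. (z + \<zeta> *s Y) $ i) holomorphic_on ball 0 1" for i
    by (simp, intro holomorphic_intros)
  then show "holomorphic_disc G (\<lambda>\<zeta>. z + \<zeta> *s Y)"
    using assms by (auto simp: holomorphic_disc_def)
  have "((\<lambda>\<zeta>. z $ i + \<zeta> * Y $ i) has_field_derivative Y $ i) (at 0)" for i
    by (auto intro!: derivative_eq_intros)
  then show "disc_tangent (\<lambda>\<zeta>. z + \<zeta> *s Y) = Y"
    by (simp add: vec_eq_iff DERIV_imp_deriv)
qed

lemma kobayashi_metric_le_affine:
  assumes "\<And>\<zeta>. cmod \<zeta> < 1 \<Longrightarrow> z + \<zeta> *s Y \<in> G"
  shows "kobayashi_metric G z (l *s Y) \<le> cmod l"
  by (rule kobayashi_metric_le[OF holomorphic_disc_affine(1)[OF assms]])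
     (use holomorphic_disc_affine(2)[OF assms] in auto)

lemma small_affine_disc:
  fixes z X :: "complex ^ 'n"
  assumes "ball z \<delta> \<subseteq> G" "\<delta> > 0"
  obtains Y where "\<And>\<zeta>. cmod \<zeta> < 1 \<Longrightarrow> z + \<zeta> *s Y \<in> G" "complex_of_real (norm X / \<delta>) *s Y = X"
proof
  fix \<zeta> :: complex assume "cmod \<zeta> < 1"
  have "norm (\<zeta> *s (complex_of_real (\<delta> / norm X) *s X)) < \<delta>"
    using \<open>\<delta> > 0\<close> \<open>cmod \<zeta> < 1\<close> by (cases "X = 0") (auto simp: norm_cscale norm_divide norm_mult)
  then show "z + \<zeta> *s (complex_of_real (\<delta> / norm X) *s X) \<in> G"
    using assms(1) by (auto simp: subset_iff dist_norm)
qed (use \<open>\<delta> > 0\<close> in \<open>cases "X = 0", auto simp: vec_eq_iff\<close>)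

lemma kobayashi_metric_le_norm:
  assumes "ball z \<delta> \<subseteq> G" "\<delta> > 0"
  shows "kobayashi_metric G z X \<le> norm X / \<delta>"
proof -
  obtain Y where Y: "\<And>\<zeta>. cmod \<zeta> < 1 \<Longrightarrow> z + \<zeta> *s Y \<in> G" "complex_of_real (norm X / \<delta>) *s Y = X"
    by (rule small_affine_disc[OF assms, of X]) (rule that)
  have "kobayashi_metric G z (complex_of_real (norm X / \<delta>) *s Y) \<le> cmod (complex_of_real (norm X / \<delta>))"
    by (rule kobayashi_metric_le_affine[OF Y(1)])
  with Y(2) \<open>\<delta> > 0\<close> show ?thesis by (simp add: norm_divide)
qed

lemma discs_exist:
  fixes z X :: "complex ^ 'n"
  assumes "open G" "z \<in> G"
  obtains f l where "holomorphic_disc G f" "f 0 = z" "l *s disc_tangent f = X"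
proof -
  obtain \<delta> where d: "\<delta> > 0" "ball z \<delta> \<subseteq> G" using assms by (meson openE)
  obtain Y where Y: "\<And>\<zeta>. cmod \<zeta> < 1 \<Longrightarrow> z + \<zeta> *s Y \<in> G" "complex_of_real (norm X / \<delta>) *s Y = X"
    by (rule small_affine_disc[OF d(2,1), of X]) (rule that)
  show ?thesis
    by (rule that[OF holomorphic_disc_affine(1)[OF Y(1)]])
       (use Y(2) holomorphic_disc_affine(2)[OF Y(1)] in auto)
qed

lemma kobayashi_metric_ge:
  assumes "open G" "z \<in> G"
    and "\<And>f l. holomorphic_disc G f \<Longrightarrow> f 0 = z \<Longrightarrow> l *s disc_tangent f = X \<Longrightarrow> c \<le> cmod l"
  shows "c \<le> kobayashi_metric G z X"
  unfolding kobayashi_metric_def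
proof (rule cInf_greatest)
  show "{cmod l |l f. holomorphic_disc G f \<and> f 0 = z \<and> l *s disc_tangent f = X} \<noteq> {}"
  proof -
    obtain f l where "holomorphic_disc G f" "f 0 = z" "l *s disc_tangent f = X"
      by (rule discs_exist[OF assms(1,2)])
    then have "cmod l \<in> {cmod l |l f. holomorphic_disc G f \<and> f 0 = z \<and> l *s disc_tangent f = X}"
      by auto
    then show ?thesis by auto
  qed
  fix x assume "x \<in> {cmod l |l f. holomorphic_disc G f \<and> f 0 = z \<and> l *s disc_tangent f = X}"
  then show "c \<le> x" using assms(3) by auto
qed

lemma kobayashi_metric_lessD:
  assumes "open G" "z \<in> G" "kobayashi_metric G z X < c"
  obtains f l where "holomorphic_disc G f" "f 0 = z" "l *s disc_tangent f = X" "cmod l < c"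
  using kobayashi_metric_ge[OF assms(1,2), of X c] assms(3) by (meson not_le)

lemma kobayashi_metric_nonneg: "open G \<Longrightarrow> z \<in> G \<Longrightarrow> 0 \<le> kobayashi_metric G z X"
  by (rule kobayashi_metric_ge) auto

text \<open>If \<open>f\<close> and \<open>l\<close> compete for \<open>X\<close>, then \<open>f\<close> and \<open>c * l\<close> compete for \<open>c X\<close>.\<close>

lemma kobayashi_metric_scaleR_le:
  assumes "open G" "z \<in> G"
  shows "kobayashi_metric G z (c *\<^sub>R X) \<le> \<bar>c\<bar> * kobayashi_metric G z X"
proof (cases "c = 0")
  case True
  obtain f l where f: "holomorphic_disc G f" "f 0 = z" "l *s disc_tangent f = X"
    by (rule discs_exist[OF assms, of X])
  show ?thesis using kobayashi_metric_le[OF f(1,2), of 0 0] True by simp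
next
  case False
  have "kobayashi_metric G z (c *\<^sub>R X) / \<bar>c\<bar> \<le> kobayashi_metric G z X"
  proof (rule kobayashi_metric_ge[OF assms])
    fix f l assume f: "holomorphic_disc G f" "f 0 = z" "l *s disc_tangent f = X"
    have "kobayashi_metric G z (c *\<^sub>R X) \<le> cmod (of_real c * l)"
      by (rule kobayashi_metric_le[OF f(1,2)])
        (simp add: scaleR_eq_cscale f(3)[symmetric] vec_eq_iff)
    then show "kobayashi_metric G z (c *\<^sub>R X) / \<bar>c\<bar> \<le> cmod l"
      using False by (simp add: norm_mult field_simps)
  qed
  then show ?thesis using False by (simp add: field_simps)
qed

text \<open>A disc through \<open>z\<close> with tangent direction \<open>X\<close> becomes one through \<open>z'\<close> with direction \<open>X'\<close> after
  a shrinking \<open>\<zeta> \<mapsto> r * \<zeta>\<close>, which makes its image relatively compact in \<open>G\<close>, and the addition of a small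
  affine map. Upper semicontinuity makes the speed of a C1 curve measurable.\<close>

lemma kobayashi_metric_upper_semicontinuous:
  fixes G :: "(complex ^ 'n) set"
  assumes "open G" "z \<in> G" "kobayashi_metric G z X < c"
  obtains e where "e > 0"
    "\<And>z' X'. dist z' z < e \<Longrightarrow> dist X' X < e \<Longrightarrow> kobayashi_metric G z' X' < c"
proof -
  have "c > 0" using assms kobayashi_metric_nonneg[OF assms(1,2), of X] by linarith
  obtain f l where f: "holomorphic_disc G f" "f 0 = z" "l *s disc_tangent f = X" "cmod l < c" "l \<noteq> 0"
  proof -
    obtain f l where f: "holomorphic_disc G f" "f 0 = z" "l *s disc_tangent f = X" "cmod l < c"
      by (rule kobayashi_metric_lessD[OF assms])
    show ?thesis
    proof (cases "l = 0")
      case True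
      have *: "z + \<zeta> *s 0 \<in> G" for \<zeta> using assms by simp
      show ?thesis
        using that[OF holomorphic_disc_affine(1)[OF *], of "of_real (c/2)"] \<open>c > 0\<close> True f(3)
        by (auto simp: vec_eq_iff)
    qed (use f that in auto)
  qed
  \<comment> \<open>Shrinking by \<open>r\<close> costs the factor \<open>1 / r\<close>, which the strict inequality can afford.\<close>
  obtain r where r: "cmod l / c < r" "r < 1"
    using dense[of "cmod l / c" 1] f(4) \<open>c > 0\<close> by auto
  have "r > 0" using r(1) \<open>c > 0\<close> by (smt (verit) divide_nonneg_pos norm_ge_zero)
  have hol: "(\<lambda>\<zeta>. f \<zeta> $ i) holomorphic_on ball 0 1" for i
    using f(1) by (auto simp: holomorphic_disc_def)
  have "continuous_on (ball 0 1) (\<lambda>x. \<chi> i. f x $ i)"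
    by (intro continuous_on_vec_lambda holomorphic_on_imp_continuous_on hol)
  then have cont: "continuous_on (cball 0 r) f"
    using r by (auto intro: continuous_on_subset)
  have "compact (f ` cball 0 r)" by (rule compact_continuous_image[OF cont]) auto
  moreover have "f ` cball 0 r \<subseteq> G" using f(1) r by (auto simp: holomorphic_disc_def image_subset_iff)
  ultimately obtain d where d: "d > 0" "(\<Union>x\<in>f ` cball 0 r. ball x d) \<subseteq> G"
    using compact_subset_open_imp_ball_epsilon_subset[OF _ \<open>open G\<close>] by metis
  show ?thesis
  proof (rule that[of "min (d/2) (d * cmod l / 2)"])
    show "min (d/2) (d * cmod l / 2) > 0" using d f by auto
    fix z' X' assume a: "dist z' z < min (d/2) (d * cmod l / 2)" "dist X' X < min (d/2) (d * cmod l / 2)"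
    define g where "g = (\<lambda>\<zeta>. f (of_real r * \<zeta>) + (z' - z) + (\<zeta> * of_real r / l) *s (X' - X))"
    have nr: "cmod (of_real r * \<zeta>) < r" if "cmod \<zeta> < 1" for \<zeta>
      using that \<open>r > 0\<close> by (simp add: norm_mult)
    have der: "((\<lambda>\<zeta>. g \<zeta> $ i) has_field_derivative
        deriv (\<lambda>\<zeta>. f \<zeta> $ i) (of_real r * \<zeta>) * of_real r + of_real r / l * (X' - X) $ i) (at \<zeta>)"
      if "cmod \<zeta> < 1" for \<zeta> i
    proof -
      have "((\<lambda>\<zeta>. f \<zeta> $ i) has_field_derivative deriv (\<lambda>\<zeta>. f \<zeta> $ i) (of_real r * \<zeta>)) (at (of_real r * \<zeta>))"
        using nr[OF that] r by (intro holomorphic_derivI[OF hol]) auto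
      then have "((\<lambda>\<zeta>. f (of_real r * \<zeta>) $ i) has_field_derivative
          deriv (\<lambda>\<zeta>. f \<zeta> $ i) (of_real r * \<zeta>) * of_real r) (at \<zeta>)"
        by (rule DERIV_chain'[rotated]) (auto intro!: derivative_eq_intros)
      then show ?thesis
        unfolding g_def using f(5) by (auto intro!: derivative_eq_intros simp: field_simps)
    qed
    have gG: "g \<zeta> \<in> G" if "cmod \<zeta> < 1" for \<zeta>
    proof -
      have "norm (g \<zeta> - f (of_real r * \<zeta>)) \<le> norm (z' - z) + norm ((\<zeta> * of_real r / l) *s (X' - X))"
        unfolding g_def using norm_triangle_ineq[of "z' - z" "(\<zeta> * of_real r / l) *s (X' - X)"]
        by (simp add: add.assoc)
      also have "\<dots> < d/2 + d/2"
      proof (rule add_less_le_mono)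
        show "norm (z' - z) < d/2" using a by (simp add: dist_norm)
        have "norm ((\<zeta> * of_real r / l) *s (X' - X)) = cmod (of_real r * \<zeta>) / cmod l * norm (X' - X)"
          unfolding norm_cscale by (simp add: norm_mult norm_divide)
        also have "\<dots> \<le> 1 / cmod l * (d * cmod l / 2)"
          using nr[OF that] r a by (intro mult_mono divide_right_mono) (auto simp: dist_norm)
        also have "\<dots> = d / 2" using f(5) by simp
        finally show "norm ((\<zeta> * of_real r / l) *s (X' - X)) \<le> d/2" .
      qed
      finally have "g \<zeta> \<in> ball (f (of_real r * \<zeta>)) d" by (simp add: dist_norm norm_minus_commute)
      moreover have "of_real r * \<zeta> \<in> cball 0 r" using nr[OF that] by auto
      ultimately show ?thesis using d(2) by blast
    qed
    have "holomorphic_disc G g"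
      unfolding holomorphic_disc_def
    proof (intro conjI allI)
      show "(\<lambda>\<zeta>. g \<zeta> $ i) holomorphic_on ball 0 1" for i
        by (subst holomorphic_on_open, simp, intro ballI exI, rule der) auto
      show "g ` ball 0 1 \<subseteq> G" using gG by auto
    qed
    moreover have "g 0 = z'" using f(2) by (simp add: g_def)
    moreover have "(l / of_real r) *s disc_tangent g = X'"
    proof -
      have "deriv (\<lambda>\<zeta>. g \<zeta> $ i) 0 = deriv (\<lambda>\<zeta>. f \<zeta> $ i) 0 * of_real r + of_real r / l * (X' - X) $ i" for i
        using DERIV_imp_deriv[OF der[of 0 i]] by simp
      moreover have "X $ i = l * deriv (\<lambda>\<zeta>. f \<zeta> $ i) 0" for i
        unfolding f(3)[symmetric] by simp
      ultimately have "l / of_real r * deriv (\<lambda>\<zeta>. g \<zeta> $ i) 0 = X' $ i" for i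
        using f(5) \<open>r > 0\<close> by (simp add: field_simps)
      then show ?thesis by (simp add: vec_eq_iff)
    qed
    ultimately have "kobayashi_metric G z' X' \<le> cmod (l / of_real r)" by (rule kobayashi_metric_le)
    also have "\<dots> < c" using r \<open>r > 0\<close> \<open>c > 0\<close> by (simp add: norm_divide field_simps)
    finally show "kobayashi_metric G z' X' < c" .
  qed
qed

section \<open>Piecewise C1 curves and their Kobayashi length\<close>

definition C1_on :: "(real \<Rightarrow> 'a::real_normed_vector) \<Rightarrow> real \<Rightarrow> real \<Rightarrow> bool" where
  "C1_on \<alpha> a b \<longleftrightarrow> (\<exists>D. continuous_on {a..b} D \<and>
     (\<forall>t\<in>{a..b}. (\<alpha> has_vector_derivative D t) (at t within {a..b})))"

text \<open>This inductive form of piecewise differentiability makes restriction and concatenation of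
  curves one-step inductions, without any bookkeeping of partitions.\<close>

inductive piecewise_C1_on :: "(real \<Rightarrow> 'a::real_normed_vector) \<Rightarrow> real \<Rightarrow> real \<Rightarrow> bool" for \<alpha> where
  refl: "piecewise_C1_on \<alpha> a a"
| step: "piecewise_C1_on \<alpha> a b \<Longrightarrow> b < c \<Longrightarrow> C1_on \<alpha> b c \<Longrightarrow> piecewise_C1_on \<alpha> a c"

lemma C1_on_subset: "C1_on \<alpha> a b \<Longrightarrow> a \<le> a' \<Longrightarrow> b' \<le> b \<Longrightarrow> C1_on \<alpha> a' b'"
  unfolding C1_on_def
  by (meson atLeastatMost_subset_iff continuous_on_subset has_vector_derivative_within_subset subset_iff)

lemma C1_on_transform:
  assumes "C1_on \<alpha> a b" "\<And>t. t \<in> {a..b} \<Longrightarrow> \<beta> t = \<alpha> t"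
  shows "C1_on \<beta> a b"
  using assms unfolding C1_on_def by (metis has_vector_derivative_transform)

lemma C1_on_affine:
  assumes "C1_on \<alpha> a b" and "(\<lambda>t. m * t + c) ` {p..q} \<subseteq> {a..b}"
  shows "C1_on (\<lambda>t. \<alpha> (m * t + c)) p q"
proof -
  obtain D where D: "continuous_on {a..b} D"
      "\<And>t. t \<in> {a..b} \<Longrightarrow> (\<alpha> has_vector_derivative D t) (at t within {a..b})"
    using assms(1) by (auto simp: C1_on_def)
  have "((\<lambda>t. \<alpha> (m * t + c)) has_vector_derivative m *\<^sub>R D (m * t + c)) (at t within {p..q})"
    if t: "t \<in> {p..q}" for t
  proof -
    have "((\<lambda>t. m * t + c) has_vector_derivative m) (at t within {p..q})"
      by (auto intro!: derivative_eq_intros simp: has_real_derivative_iff_has_vector_derivative[symmetric])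
    moreover have "(\<alpha> has_vector_derivative D (m * t + c)) (at (m * t + c) within (\<lambda>t. m * t + c) ` {p..q})"
    proof (rule has_vector_derivative_within_subset[OF D(2) assms(2)])
      show "m * t + c \<in> {a..b}" using t assms(2) by blast
    qed
    ultimately show ?thesis
      using vector_diff_chain_within[of "\<lambda>t. m * t + c" m t "{p..q}" \<alpha>] by (simp add: o_def)
  qed
  moreover have "continuous_on {p..q} (\<lambda>t. m *\<^sub>R D (m * t + c))"
    by (intro continuous_intros continuous_on_compose2[OF D(1)]) (use assms(2) in auto)
  ultimately show ?thesis unfolding C1_on_def by blast
qed

lemma piecewise_C1_on_le: "piecewise_C1_on \<alpha> a b \<Longrightarrow> a \<le> b"
  by (induction rule: piecewise_C1_on.induct) auto

lemma C1_on_imp_piecewise_C1_on: "a \<le> b \<Longrightarrow> C1_on \<alpha> a b \<Longrightarrow> piecewise_C1_on \<alpha> a b"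
  using piecewise_C1_on.intros by (metis order_le_less)

lemma piecewise_C1_on_trans: "piecewise_C1_on \<alpha> b c \<Longrightarrow> piecewise_C1_on \<alpha> a b \<Longrightarrow> piecewise_C1_on \<alpha> a c"
  by (induction rule: piecewise_C1_on.induct) (auto intro: piecewise_C1_on.step)

lemma piecewise_C1_on_initial: "piecewise_C1_on \<alpha> a c \<Longrightarrow> x \<in> {a..c} \<Longrightarrow> piecewise_C1_on \<alpha> a x"
proof (induction rule: piecewise_C1_on.induct)
  case (step a b c)
  then show ?case
    by (cases "x \<le> b") (auto intro!: piecewise_C1_on.step[of \<alpha> a b x] intro: C1_on_subset)
qed (auto intro: piecewise_C1_on.refl)

lemma piecewise_C1_on_final: "piecewise_C1_on \<alpha> a c \<Longrightarrow> x \<in> {a..c} \<Longrightarrow> piecewise_C1_on \<alpha> x c"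
proof (induction rule: piecewise_C1_on.induct)
  case (step a b c)
  show ?case
  proof (cases "x \<le> b")
    case True
    then show ?thesis using step by (auto intro: piecewise_C1_on.step)
  next
    case False
    then show ?thesis using step by (intro C1_on_imp_piecewise_C1_on) (auto intro: C1_on_subset)
  qed
qed (auto intro: piecewise_C1_on.refl)

lemma piecewise_C1_on_transform: "piecewise_C1_on \<alpha> a b \<Longrightarrow> (\<And>t. t \<in> {a..b} \<Longrightarrow> \<beta> t = \<alpha> t) \<Longrightarrow> piecewise_C1_on \<beta> a b"
proof (induction rule: piecewise_C1_on.induct)
  case (step a b c)
  have "a \<le> b" using step piecewise_C1_on_le by blast
  show ?case
    by (rule piecewise_C1_on.step[OF _ \<open>b < c\<close> C1_on_transform[OF step.hyps(3)]])
       (use step \<open>a \<le> b\<close> in auto)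
qed (auto intro: piecewise_C1_on.refl)

lemma piecewise_C1_on_affine: "piecewise_C1_on \<alpha> a b \<Longrightarrow> m > 0 \<Longrightarrow> piecewise_C1_on (\<lambda>t. \<alpha> (m * t + c)) ((a - c) / m) ((b - c) / m)"
proof (induction rule: piecewise_C1_on.induct)
  case (step a b d)
  show ?case
  proof (rule piecewise_C1_on.step)
    show "C1_on (\<lambda>t. \<alpha> (m * t + c)) ((b - c) / m) ((d - c) / m)"
      by (rule C1_on_affine[OF step.hyps(3)]) (use step in \<open>auto simp: field_simps\<close>)
  qed (use step in \<open>auto simp: divide_strict_right_mono\<close>)
qed (auto intro: piecewise_C1_on.refl)

lemma piecewise_C1_on_reverse: "piecewise_C1_on \<alpha> a b \<Longrightarrow> piecewise_C1_on (\<lambda>t. \<alpha> (- t)) (- b) (- a)"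
proof (induction rule: piecewise_C1_on.induct)
  case (step a b c)
  have "C1_on (\<lambda>t. \<alpha> (-1 * t + 0)) (- c) (- b)"
    by (rule C1_on_affine[OF step.hyps(3)]) auto
  with step show ?case
    by (intro piecewise_C1_on_trans[OF step.IH] C1_on_imp_piecewise_C1_on) auto
qed (auto intro: piecewise_C1_on.refl)

lemma piecewise_C1_curve_iff: "piecewise_C1_curve \<alpha> \<longleftrightarrow> piecewise_C1_on \<alpha> 0 1"
proof
  assume "piecewise_C1_curve \<alpha>"
  then obtain m s where s: "s 0 = 0" "s m = 1" "\<And>j. j < m \<Longrightarrow> s j < s (Suc j) \<and> C1_on \<alpha> (s j) (s (Suc j))"
    unfolding piecewise_C1_curve_def C1_on_def by blast
  have "j \<le> m \<Longrightarrow> piecewise_C1_on \<alpha> 0 (s j)" for j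
    by (induction j) (use s in \<open>auto intro: piecewise_C1_on.intros\<close>)
  then show "piecewise_C1_on \<alpha> 0 1" using s by force
next
  have "piecewise_C1_on \<alpha> a b \<Longrightarrow> \<exists>(m::nat) s. s 0 = a \<and> s m = b \<and>
        (\<forall>j<m. s j < s (Suc j) \<and> C1_on \<alpha> (s j) (s (Suc j)))" for a b
  proof (induction rule: piecewise_C1_on.induct)
    case (refl a)
    show ?case by (rule exI[of _ 0], rule exI[of _ "\<lambda>_. a"]) auto
  next
    case (step a b c)
    then obtain m :: nat and s where s: "s 0 = a" "s m = b" "\<forall>j<m. s j < s (Suc j) \<and> C1_on \<alpha> (s j) (s (Suc j))"
      by blast
    show ?case
      by (rule exI[of _ "Suc m"], rule exI[of _ "s(Suc m := c)"])
         (use s step in \<open>auto simp: less_Suc_eq\<close>)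
  qed
  then show "piecewise_C1_on \<alpha> 0 1 \<Longrightarrow> piecewise_C1_curve \<alpha>"
    unfolding piecewise_C1_curve_def C1_on_def by meson
qed

lemma piecewise_C1_on_differentiable:
  "piecewise_C1_on \<alpha> a b \<Longrightarrow> \<exists>S. finite S \<and> (\<forall>t\<in>{a..b} - S. (\<alpha> has_vector_derivative vector_derivative \<alpha> (at t)) (at t))"
proof (induction rule: piecewise_C1_on.induct)
  case (refl a)
  show ?case by (rule exI[of _ "{a}"]) auto
next
  case (step a b c)
  then obtain S D where S: "finite S" "\<forall>t\<in>{a..b} - S. (\<alpha> has_vector_derivative vector_derivative \<alpha> (at t)) (at t)"
    and D: "\<And>t. t \<in> {b..c} \<Longrightarrow> (\<alpha> has_vector_derivative D t) (at t within {b..c})"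
    unfolding C1_on_def by blast
  have "(\<alpha> has_vector_derivative D t) (at t)" if "t \<in> {b<..<c}" for t
    using D[of t] that by (auto simp: at_within_Icc_at)
  then have "(\<alpha> has_vector_derivative vector_derivative \<alpha> (at t)) (at t)" if "t \<in> {b<..<c}" for t
    using that by (metis vector_derivative_at)
  moreover have "t \<in> {b<..<c} \<or> t \<in> {a..b} - S" if "t \<in> {a..c} - (S \<union> {b, c})" for t
    using that by auto
  ultimately show ?case using S by (intro exI[of _ "S \<union> {b, c}"]) blast
qed

abbreviation kobayashi_speed :: "(complex ^ 'n) set \<Rightarrow> (real \<Rightarrow> complex ^ 'n) \<Rightarrow> real \<Rightarrow> real" where
  "kobayashi_speed G \<alpha> t \<equiv> kobayashi_metric G (\<alpha> t) (vector_derivative \<alpha> (at t))"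

text \<open>The full derivative at \<open>t\<close> is arbitrary at the finitely many break points, which the
  integral ignores.\<close>

definition kobayashi_length :: "(complex ^ 'n) set \<Rightarrow> (real \<Rightarrow> complex ^ 'n) \<Rightarrow> real \<Rightarrow> real \<Rightarrow> real" where
  "kobayashi_length G \<alpha> a b = integral {a..b} (kobayashi_speed G \<alpha>)"

text \<open>The speed is upper semicontinuous, hence measurable, in the interior, and bounded because the
  image of the curve is compact in \<open>G\<close> and so has a uniform neighbourhood in \<open>G\<close>.\<close>

lemma C1_on_speed_integrable:
  fixes G :: "(complex ^ 'n) set"
  assumes G: "open G" and "C1_on \<alpha> a b" and im: "\<alpha> ` {a..b} \<subseteq> G"
  shows "kobayashi_speed G \<alpha> integrable_on {a..b}"
proof -
  obtain D where D: "continuous_on {a..b} D"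
      "\<And>t. t \<in> {a..b} \<Longrightarrow> (\<alpha> has_vector_derivative D t) (at t within {a..b})"
    using assms(2) by (auto simp: C1_on_def)
  have ca: "continuous_on {a..b} \<alpha>"
    using D(2) has_vector_derivative_continuous unfolding continuous_on_eq_continuous_within by blast
  define K where "K = (\<lambda>t. kobayashi_metric G (\<alpha> t) (D t))"
  have meas: "K \<in> borel_measurable (lebesgue_on {a<..<b})"
    unfolding borel_measurable_iff_less
  proof
    fix c
    have "open {t\<in>{a<..<b}. K t < c}"
      unfolding open_dist
    proof
      fix t assume t: "t \<in> {t\<in>{a<..<b}. K t < c}"
      have tG: "\<alpha> t \<in> G" using t im by auto
      have "kobayashi_metric G (\<alpha> t) (D t) < c" using t by (simp add: K_def)
      then obtain e where e: "e > 0" "\<And>z' X'. dist z' (\<alpha> t) < e \<Longrightarrow> dist X' (D t) < e \<Longrightarrow> kobayashi_metric G z' X' < c"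
        using kobayashi_metric_upper_semicontinuous[OF G tG] that by (metis (no_types))
      obtain d1 where d1: "d1 > 0" "\<And>s. s \<in> {a..b} \<Longrightarrow> dist s t < d1 \<Longrightarrow> dist (\<alpha> s) (\<alpha> t) < e"
        using ca t e(1) unfolding continuous_on_iff by (metis (no_types, lifting) greaterThanLessThan_subseteq_atLeastAtMost_iff mem_Collect_eq order_refl subset_iff)
      obtain d2 where d2: "d2 > 0" "\<And>s. s \<in> {a..b} \<Longrightarrow> dist s t < d2 \<Longrightarrow> dist (D s) (D t) < e"
        using D(1) t e(1) unfolding continuous_on_iff by (metis (no_types, lifting) greaterThanLessThan_subseteq_atLeastAtMost_iff mem_Collect_eq order_refl subset_iff)
      obtain d3 where d3: "d3 > 0" "\<And>s. dist s t < d3 \<Longrightarrow> s \<in> {a<..<b}"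
        using t open_greaterThanLessThan[of a b] unfolding open_dist by blast
      show "\<exists>d>0. \<forall>s. dist s t < d \<longrightarrow> s \<in> {t\<in>{a<..<b}. K t < c}"
        by (rule exI[of _ "min d1 (min d2 d3)"])
           (use d1 d2 d3 e(2) in \<open>force simp: K_def\<close>)
    qed
    then show "{w \<in> space (lebesgue_on {a<..<b}). K w < c} \<in> sets (lebesgue_on {a<..<b})"
      by (simp add: space_restrict_space sets_restrict_space_iff borel_open subset_iff)
  qed
  have "compact (\<alpha> ` {a..b})" using ca by (intro compact_continuous_image) auto
  then obtain d where d: "d > 0" "(\<Union>x\<in>\<alpha> ` {a..b}. ball x d) \<subseteq> G"
    using compact_subset_open_imp_ball_epsilon_subset[OF _ G im] by blast
  have "bounded (D ` {a..b})" using D(1) by (intro compact_imp_bounded compact_continuous_image) auto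
  then obtain M where M: "\<And>t. t \<in> {a..b} \<Longrightarrow> norm (D t) \<le> M" unfolding bounded_iff by blast
  have bound: "norm (K t) \<le> M / d" if "t \<in> {a<..<b}" for t
  proof -
    have "t \<in> {a..b}" using that by simp
    then have "\<alpha> t \<in> G" "ball (\<alpha> t) d \<subseteq> G" using d(2) im by blast+
    then have "0 \<le> K t" "K t \<le> norm (D t) / d"
      unfolding K_def using kobayashi_metric_nonneg[OF G] kobayashi_metric_le_norm d(1) by auto
    moreover have "norm (D t) / d \<le> M / d" using M[of t] that d(1) by (simp add: divide_right_mono)
    ultimately show ?thesis by simp
  qed
  have "K integrable_on {a<..<b}"
    by (rule measurable_bounded_by_integrable_imp_integrable[OF meas, of "\<lambda>_. M / d"])
       (use bound in \<open>auto simp: integrable_on_Icc_iff_Ioo[symmetric]\<close>)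
  then have "K integrable_on {a..b}" by (simp add: integrable_on_Icc_iff_Ioo)
  then show ?thesis
  proof (rule integrable_spike_finite[of "{a, b}", rotated 2])
    fix t assume "t \<in> {a..b} - {a, b}"
    then have "(\<alpha> has_vector_derivative D t) (at t)" using D(2)[of t] by (auto simp: at_within_Icc_at)
    then show "kobayashi_speed G \<alpha> t = K t" by (simp add: K_def vector_derivative_at)
  qed auto
qed

lemma piecewise_C1_on_speed_integrable:
  fixes G :: "(complex ^ 'n) set"
  assumes G: "open G"
  shows "piecewise_C1_on \<alpha> a b \<Longrightarrow> \<alpha> ` {a..b} \<subseteq> G \<Longrightarrow> kobayashi_speed G \<alpha> integrable_on {a..b}"
proof (induction rule: piecewise_C1_on.induct)
  case (step a b c)
  have "a \<le> b" using step piecewise_C1_on_le by blast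
  show ?case
  proof (rule Henstock_Kurzweil_Integration.integrable_combine[OF \<open>a \<le> b\<close>])
    show "kobayashi_speed G \<alpha> integrable_on {b..c}"
      by (rule C1_on_speed_integrable[OF G step.hyps(3)]) (use step \<open>a \<le> b\<close> in auto)
  qed (use step \<open>a \<le> b\<close> in \<open>auto simp: image_subset_iff\<close>)
qed (auto intro: integrable_on_refl[where 'a=real, simplified])

lemma kobayashi_length_nonneg:
  assumes "open G" "\<alpha> ` {a..b} \<subseteq> G"
  shows "0 \<le> kobayashi_length G \<alpha> a b"
  unfolding kobayashi_length_def
proof (cases "kobayashi_speed G \<alpha> integrable_on {a..b}")
  case True
  then show "0 \<le> integral {a..b} (kobayashi_speed G \<alpha>)"
    by (rule integral_nonneg) (use assms kobayashi_metric_nonneg in blast)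
qed (simp add: not_integrable_integral)

lemma kobayashi_length_split:
  assumes "open G" "piecewise_C1_on \<alpha> a b" "\<alpha> ` {a..b} \<subseteq> G" "c \<in> {a..b}"
  shows "kobayashi_length G \<alpha> a c + kobayashi_length G \<alpha> c b = kobayashi_length G \<alpha> a b"
  unfolding kobayashi_length_def
  by (rule Henstock_Kurzweil_Integration.integral_combine) (use assms piecewise_C1_on_speed_integrable in auto)

text \<open>The case \<open>m > 0\<close> serves to move and rescale the parameter interval, the case \<open>m = - 1\<close>
  to reverse a curve.\<close>

lemma kobayashi_length_affine_le:
  fixes G :: "(complex ^ 'n) set"
  assumes G: "open G" and pc: "piecewise_C1_on \<alpha> a b" and im: "\<alpha> ` {a..b} \<subseteq> G" and m: "m \<noteq> 0"
    and J: "(\<lambda>t. m * t + c) ` {p..q} = {a..b}" and pcb: "piecewise_C1_on (\<lambda>t. \<alpha> (m * t + c)) p q"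
  shows "kobayashi_length G (\<lambda>t. \<alpha> (m * t + c)) p q \<le> kobayashi_length G \<alpha> a b"
proof -
  let ?\<beta> = "\<lambda>t. \<alpha> (m * t + c)"
  have "(\<lambda>x. (1 / m) *\<^sub>R x + -((1 / m) *\<^sub>R c)) ` cbox a b = {p..q}"
    unfolding cbox_interval J[symmetric] image_image using m by (simp add: field_simps)
  moreover have "(kobayashi_speed G \<alpha> has_integral kobayashi_length G \<alpha> a b) (cbox a b)"
    using piecewise_C1_on_speed_integrable[OF G pc im] by (simp add: kobayashi_length_def has_integral_integral)
  ultimately have "((\<lambda>t. kobayashi_speed G \<alpha> (m * t + c)) has_integral kobayashi_length G \<alpha> a b / \<bar>m\<bar>) {p..q}"
    using has_integral_affinity[of "kobayashi_speed G \<alpha>" _ a b m c] m by simp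
  from has_integral_mult_right[OF this, of "\<bar>m\<bar>"] m
  have int: "((\<lambda>t. \<bar>m\<bar> * kobayashi_speed G \<alpha> (m * t + c)) has_integral kobayashi_length G \<alpha> a b) {p..q}" by simp
  obtain S where S: "finite S" "\<forall>t\<in>{a..b} - S. (\<alpha> has_vector_derivative vector_derivative \<alpha> (at t)) (at t)"
    using piecewise_C1_on_differentiable[OF pc] by blast
  define S' where "S' = (\<lambda>t. m * t + c) -` S"
  have "finite S'" unfolding S'_def
    by (rule finite_vimageI[OF S(1)]) (use m in \<open>auto simp: inj_on_def\<close>)
  have le: "kobayashi_speed G ?\<beta> t \<le> \<bar>m\<bar> * kobayashi_speed G \<alpha> (m * t + c)" if t: "t \<in> {p..q} - S'" for t
  proof -
    have mem: "m * t + c \<in> {a..b}" using t J by blast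
    have "(\<alpha> has_vector_derivative vector_derivative \<alpha> (at (m * t + c))) (at (m * t + c))"
      using t S mem by (auto simp: S'_def)
    moreover have "((\<lambda>t. m * t + c) has_vector_derivative m) (at t)"
      by (auto intro!: derivative_eq_intros simp: has_real_derivative_iff_has_vector_derivative[symmetric])
    ultimately have "(?\<beta> has_vector_derivative m *\<^sub>R vector_derivative \<alpha> (at (m * t + c))) (at t)"
      using vector_diff_chain_at[of "\<lambda>t. m * t + c" m t \<alpha>] by (simp add: o_def)
    then have "vector_derivative ?\<beta> (at t) = m *\<^sub>R vector_derivative \<alpha> (at (m * t + c))"
      by (rule vector_derivative_at)
    moreover have "\<alpha> (m * t + c) \<in> G" using im mem by blast
    ultimately show ?thesis
      by (simp add: kobayashi_metric_scaleR_le[OF G])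
  qed
  have "(kobayashi_speed G ?\<beta> has_integral kobayashi_length G ?\<beta> p q) {p..q}"
    unfolding kobayashi_length_def
    by (rule integrable_integral, rule piecewise_C1_on_speed_integrable[OF G pcb]) (use im J in blast)
  then have "((\<lambda>t. if t \<in> S' then 0 else kobayashi_speed G ?\<beta> t) has_integral kobayashi_length G ?\<beta> p q) {p..q}"
    by (rule has_integral_spike_finite[OF \<open>finite S'\<close>, rotated]) auto
  moreover have "((\<lambda>t. if t \<in> S' then 0 else \<bar>m\<bar> * kobayashi_speed G \<alpha> (m * t + c)) has_integral kobayashi_length G \<alpha> a b) {p..q}"
    by (rule has_integral_spike_finite[OF \<open>finite S'\<close> _ int]) auto
  ultimately show ?thesis by (rule has_integral_le) (use le in auto)
qed

lemma kobayashi_length_le: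
  assumes G: "open G" and "piecewise_C1_on \<alpha> a b" "\<alpha> ` {a..b} \<subseteq> G"
    and "\<And>t. t \<in> {a<..<b} \<Longrightarrow> kobayashi_speed G \<alpha> t \<le> C"
  shows "kobayashi_length G \<alpha> a b \<le> C * (b - a)"
proof -
  have "a \<le> b" using assms piecewise_C1_on_le by blast
  have "(kobayashi_speed G \<alpha> has_integral kobayashi_length G \<alpha> a b) {a..b}"
    unfolding kobayashi_length_def
    by (rule integrable_integral, rule piecewise_C1_on_speed_integrable[OF G assms(2,3)])
  then have "(kobayashi_speed G \<alpha> has_integral kobayashi_length G \<alpha> a b) {a<..<b}"
    by (simp add: has_integral_Icc_iff_Ioo)
  moreover have "((\<lambda>_. C) has_integral C * (b - a)) {a<..<b}"
    using has_integral_const_real[of C a b] \<open>a \<le> b\<close> by (simp add: has_integral_Icc_iff_Ioo mult.commute)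
  ultimately show ?thesis by (rule has_integral_le) (use assms(4) in auto)
qed

section \<open>The Kobayashi distance\<close>

text \<open>Inside \<open>{0..1}\<close> the derivative within the interval is the full derivative, and the two end points
  have measure 0.\<close>

lemma nn_integral_speed:
  fixes G :: "(complex ^ 'n) set"
  assumes G: "open G" and pc: "piecewise_C1_on \<alpha> 0 1" and im: "\<alpha> ` {0..1} \<subseteq> G"
  shows "(\<integral>\<^sup>+t\<in>{0..1}. ennreal (kobayashi_metric G (\<alpha> t) (vector_derivative \<alpha> (at t within {0..1}))) \<partial>lborel)
    = ennreal (kobayashi_length G \<alpha> 0 1)"
proof -
  let ?v = "\<lambda>t. kobayashi_metric G (\<alpha> t) (vector_derivative \<alpha> (at t within {0..1}))"
  have "(kobayashi_speed G \<alpha> has_integral kobayashi_length G \<alpha> 0 1) {0..1}"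
    unfolding kobayashi_length_def
    by (rule integrable_integral, rule piecewise_C1_on_speed_integrable[OF G pc im])
  then have "(?v has_integral kobayashi_length G \<alpha> 0 1) {0..1}"
    by (rule has_integral_spike_finite[of "{0,1}", rotated 2]) (auto simp: at_within_Icc_at)
  then have "(\<integral>\<^sup>+t. ennreal (indicator {0..1} t * ?v t) \<partial>lborel) = ennreal (kobayashi_length G \<alpha> 0 1)"
    by (rule nn_integral_has_integral_lebesgue[rotated])
       (use im in \<open>auto intro!: kobayashi_metric_nonneg[OF G]\<close>)
  moreover have "ennreal (indicator {0..1} t * ?v t) = ennreal (?v t) * indicator {0..1} t" for t
    by (auto simp: indicator_def)
  ultimately show ?thesis by simp
qed

lemma kobayashi_dist_eq_Inf_length:
  fixes G :: "(complex ^ 'n) set"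
  assumes G: "open G"
  shows "kobayashi_dist G p q = enn2real (INF \<alpha> \<in> {\<alpha>. piecewise_C1_on \<alpha> 0 1 \<and> \<alpha> ` {0..1} \<subseteq> G \<and> \<alpha> 0 = p \<and> \<alpha> 1 = q}.
       ennreal (kobayashi_length G \<alpha> 0 1))"
  unfolding kobayashi_dist_def piecewise_C1_curve_iff
  by (intro arg_cong[where f = enn2real] INF_cong refl nn_integral_speed G) auto

lemma kobayashi_dist_nonneg: "0 \<le> kobayashi_dist G p q"
  by (simp add: kobayashi_dist_def)

lemma kobayashi_dist_le_unit_length:
  fixes G :: "(complex ^ 'n) set"
  assumes G: "open G" and pc: "piecewise_C1_on \<alpha> 0 1" and im: "\<alpha> ` {0..1} \<subseteq> G"
  shows "kobayashi_dist G (\<alpha> 0) (\<alpha> 1) \<le> kobayashi_length G \<alpha> 0 1"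
proof -
  have "kobayashi_dist G (\<alpha> 0) (\<alpha> 1) \<le> enn2real (ennreal (kobayashi_length G \<alpha> 0 1))"
    unfolding kobayashi_dist_eq_Inf_length[OF G]
    by (rule enn2real_mono[OF INF_lower]) (use assms in auto)
  then show ?thesis using kobayashi_length_nonneg[OF G im] by simp
qed

lemma kobayashi_dist_refl:
  assumes "open G" "p \<in> G"
  shows "kobayashi_dist G p p = 0"
proof -
  have "C1_on (\<lambda>_. p) 0 1" unfolding C1_on_def by (rule exI[of _ "\<lambda>_. 0"]) auto
  then have pc: "piecewise_C1_on (\<lambda>_. p) 0 1" by (intro C1_on_imp_piecewise_C1_on) auto
  obtain d where d: "d > 0" "ball p d \<subseteq> G" using assms openE by blast
  have "kobayashi_length G (\<lambda>_. p) 0 1 \<le> 0 * (1 - 0)"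
    by (rule kobayashi_length_le[OF assms(1) pc])
       (use kobayashi_metric_le_norm[OF d(2,1), of 0] assms in auto)
  then show ?thesis
    using kobayashi_dist_le_unit_length[OF assms(1) pc] assms(2) kobayashi_dist_nonneg[of G p p]
    by (simp add: image_subset_iff)
qed

lemma kobayashi_dist_le_length:
  fixes G :: "(complex ^ 'n) set"
  assumes G: "open G" and pc: "piecewise_C1_on \<alpha> a b" and im: "\<alpha> ` {a..b} \<subseteq> G"
  shows "kobayashi_dist G (\<alpha> a) (\<alpha> b) \<le> kobayashi_length G \<alpha> a b"
proof (cases "a = b")
  case True
  then show ?thesis using kobayashi_dist_refl[OF G, of "\<alpha> a"] kobayashi_length_nonneg[OF G im] im by auto
next
  case False
  then have "a < b" using piecewise_C1_on_le[OF pc] by simp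
  let ?\<beta> = "\<lambda>t. \<alpha> ((b - a) * t + a)"
  have pcb: "piecewise_C1_on ?\<beta> 0 1"
    using piecewise_C1_on_affine[OF pc, of "b - a" a] \<open>a < b\<close> by simp
  have J: "(\<lambda>t. (b - a) * t + a) ` {0..1} = {a..b}"
    using \<open>a < b\<close> image_affinity_atLeastAtMost[of "b - a" a 0 1] by simp
  have "kobayashi_dist G (?\<beta> 0) (?\<beta> 1) \<le> kobayashi_length G ?\<beta> 0 1"
    by (rule kobayashi_dist_le_unit_length[OF G pcb]) (use im J in blast)
  also have "\<dots> \<le> kobayashi_length G \<alpha> a b"
    by (rule kobayashi_length_affine_le[OF G pc im _ J pcb]) (use \<open>a < b\<close> in auto)
  finally show ?thesis by simp
qed

text \<open>An open connected set is connected by polynomial paths, so the infimum runs over a non-empty set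
  of finite lengths, and its conversion to a real number is faithful.\<close>

lemma kobayashi_dist_almost_attained:
  fixes G :: "(complex ^ 'n) set"
  assumes G: "open G" "connected G" "p \<in> G" "q \<in> G" and "e > 0"
  obtains \<alpha> where "piecewise_C1_on \<alpha> 0 1" "\<alpha> ` {0..1} \<subseteq> G" "\<alpha> 0 = p" "\<alpha> 1 = q"
    "kobayashi_length G \<alpha> 0 1 < kobayashi_dist G p q + e"
proof -
  let ?A = "{\<alpha>. piecewise_C1_on \<alpha> 0 1 \<and> \<alpha> ` {0..1} \<subseteq> G \<and> \<alpha> 0 = p \<and> \<alpha> 1 = q}"
  let ?I = "INF \<alpha> \<in> ?A. ennreal (kobayashi_length G \<alpha> 0 1)"
  obtain g where g: "polynomial_function g" "path_image g \<subseteq> G" "pathstart g = p" "pathfinish g = q"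
    using connected_open_polynomial_connected[OF G] by blast
  obtain g' where g': "polynomial_function g'" "\<And>x. (g has_vector_derivative g' x) (at x)"
    using has_vector_derivative_polynomial_function[OF g(1)] by metis
  have "C1_on g 0 1" unfolding C1_on_def
    using continuous_on_polymonial_function[OF g'(1)] g'(2) has_vector_derivative_at_within by blast
  then have "piecewise_C1_on g 0 1" by (intro C1_on_imp_piecewise_C1_on) auto
  then have gA: "g \<in> ?A" using g by (auto simp: path_image_def pathstart_def pathfinish_def)
  have "?I \<le> ennreal (kobayashi_length G g 0 1)" using gA by (rule INF_lower)
  then have "?I < top" by (simp add: order_le_less_trans)
  then have "?I = ennreal (kobayashi_dist G p q)"
    unfolding kobayashi_dist_eq_Inf_length[OF G(1)] by simp
  also have "\<dots> < ennreal (kobayashi_dist G p q + e)"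
    using \<open>e > 0\<close> kobayashi_dist_nonneg[of G p q] by (simp add: ennreal_less_iff)
  finally obtain \<alpha> where a: "\<alpha> \<in> ?A" "ennreal (kobayashi_length G \<alpha> 0 1) < ennreal (kobayashi_dist G p q + e)"
    unfolding INF_less_iff by blast
  have "kobayashi_length G \<alpha> 0 1 < kobayashi_dist G p q + e"
    using a kobayashi_length_nonneg[OF G(1), of \<alpha> 0 1] by (auto simp: ennreal_less_iff)
  then show ?thesis using a that by auto
qed

lemma kobayashi_dist_commute_le:
  fixes G :: "(complex ^ 'n) set"
  assumes G: "open G" "connected G" "p \<in> G" "q \<in> G"
  shows "kobayashi_dist G q p \<le> kobayashi_dist G p q"
proof (rule field_le_epsilon)
  fix e :: real assume "e > 0"
  then obtain \<alpha> where a: "piecewise_C1_on \<alpha> 0 1" "\<alpha> ` {0..1} \<subseteq> G" "\<alpha> 0 = p" "\<alpha> 1 = q"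
      "kobayashi_length G \<alpha> 0 1 < kobayashi_dist G p q + e"
    by (rule kobayashi_dist_almost_attained[OF G])
  have J: "(\<lambda>t. (-1) * t + 0) ` {-1..- 0} = {0..1::real}"
    by (auto simp: image_iff intro!: bexI[of _ "- x" for x])
  have pc: "piecewise_C1_on (\<lambda>t. \<alpha> ((-1) * t + 0)) (-1) (- 0)" using piecewise_C1_on_reverse[OF a(1)] by simp
  have "kobayashi_dist G (\<alpha> ((-1) * (-1) + 0)) (\<alpha> ((-1) * (- 0) + 0)) \<le> kobayashi_length G (\<lambda>t. \<alpha> ((-1) * t + 0)) (-1) (- 0)"
    by (rule kobayashi_dist_le_length[OF G(1) pc]) (use a(2) J in blast)
  also have "\<dots> \<le> kobayashi_length G \<alpha> 0 1"
    by (rule kobayashi_length_affine_le[OF G(1) a(1,2) _ J pc]) simp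
  finally show "kobayashi_dist G q p \<le> kobayashi_dist G p q + e" using a by simp
qed

lemma kobayashi_dist_commute:
  fixes G :: "(complex ^ 'n) set"
  assumes "open G" "connected G" "p \<in> G" "q \<in> G"
  shows "kobayashi_dist G p q = kobayashi_dist G q p"
  using kobayashi_dist_commute_le assms by (metis order_antisym)

lemma kobayashi_length_cong:
  assumes "\<And>t. t \<in> {a<..<b} \<Longrightarrow> \<beta> t = \<alpha> t"
  shows "kobayashi_length G \<beta> a b = kobayashi_length G \<alpha> a b"
  unfolding kobayashi_length_def
proof (rule integral_spike[of "{a, b}"])
  fix t assume t: "t \<in> {a..b} - {a, b}"
  then have "\<forall>\<^sub>F x in nhds t. x \<in> {a<..<b}" by (intro eventually_nhds_in_open) auto
  then have "\<forall>\<^sub>F x in nhds t. x \<in> UNIV \<longrightarrow> \<alpha> x = \<beta> x" by eventually_elim (simp add: assms)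
  then have "vector_derivative \<alpha> (at t) = vector_derivative \<beta> (at t)"
    by (rule vector_derivative_cong_eq) auto
  then show "kobayashi_speed G \<alpha> t = kobayashi_speed G \<beta> t" using assms[of t] t by simp
qed auto

lemma kobayashi_dist_triangle:
  fixes G :: "(complex ^ 'n) set"
  assumes G: "open G" "connected G" and "p \<in> G" "q \<in> G" "r \<in> G"
  shows "kobayashi_dist G p r \<le> kobayashi_dist G p q + kobayashi_dist G q r"
proof (rule field_le_epsilon)
  fix e :: real assume "e > 0"
  then have e: "e/2 > 0" by simp
  obtain \<alpha> where a: "piecewise_C1_on \<alpha> 0 1" "\<alpha> ` {0..1} \<subseteq> G" "\<alpha> 0 = p" "\<alpha> 1 = q"
      "kobayashi_length G \<alpha> 0 1 < kobayashi_dist G p q + e/2"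
    using kobayashi_dist_almost_attained[OF G assms(3,4) e] by metis
  obtain \<beta> where b: "piecewise_C1_on \<beta> 0 1" "\<beta> ` {0..1} \<subseteq> G" "\<beta> 0 = q" "\<beta> 1 = r"
      "kobayashi_length G \<beta> 0 1 < kobayashi_dist G q r + e/2"
    using kobayashi_dist_almost_attained[OF G assms(4,5) e] by metis
  define \<gamma> where "\<gamma> = (\<lambda>t. if t \<le> 1 then \<alpha> t else \<beta> (t - 1))"
  have b': "piecewise_C1_on (\<lambda>t. \<beta> (1 * t + (-1))) 1 2" using piecewise_C1_on_affine[OF b(1), of 1 "-1"] by simp
  have J: "(\<lambda>t. 1 * t + (-1)) ` {1..2} = {0..1::real}"
    by (auto simp: image_iff intro!: bexI[of _ "x + 1" for x])
  have g1: "piecewise_C1_on \<gamma> 0 1" by (rule piecewise_C1_on_transform[OF a(1)]) (auto simp: \<gamma>_def)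
  have g2: "piecewise_C1_on \<gamma> 1 2" by (rule piecewise_C1_on_transform[OF b']) (use a b in \<open>auto simp: \<gamma>_def\<close>)
  have im: "\<gamma> ` {0..2} \<subseteq> G" using a(2) b(2) by (auto simp: \<gamma>_def image_subset_iff)
  have "kobayashi_dist G (\<gamma> 0) (\<gamma> 2) \<le> kobayashi_length G \<gamma> 0 2"
    by (rule kobayashi_dist_le_length[OF G(1) piecewise_C1_on_trans[OF g2 g1] im])
  also have "\<dots> = kobayashi_length G \<gamma> 0 1 + kobayashi_length G \<gamma> 1 2"
    using kobayashi_length_split[OF G(1) piecewise_C1_on_trans[OF g2 g1] im, of 1] by simp
  also have "kobayashi_length G \<gamma> 0 1 = kobayashi_length G \<alpha> 0 1"
    by (rule kobayashi_length_cong) (auto simp: \<gamma>_def)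
  also have "kobayashi_length G \<gamma> 1 2 = kobayashi_length G (\<lambda>t. \<beta> (1 * t + (-1))) 1 2"
    by (rule kobayashi_length_cong) (auto simp: \<gamma>_def)
  also have "\<dots> \<le> kobayashi_length G \<beta> 0 1"
    by (rule kobayashi_length_affine_le[OF G(1) b(1,2) _ J b']) simp
  finally show "kobayashi_dist G p r \<le> kobayashi_dist G p q + kobayashi_dist G q r + e"
    using a b by (simp add: \<gamma>_def)
qed

lemma kobayashi_dist_le_smooth:
  fixes G :: "(complex ^ 'n) set"
  assumes G: "open G" and "a \<le> b" and im: "\<alpha> ` {a..b} \<subseteq> G"
    and D: "\<And>t. t \<in> {a..b} \<Longrightarrow> (\<alpha> has_vector_derivative D t) (at t)" "continuous_on {a..b} D"
    and C: "\<And>t. t \<in> {a..b} \<Longrightarrow> kobayashi_metric G (\<alpha> t) (D t) \<le> C"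
  shows "kobayashi_dist G (\<alpha> a) (\<alpha> b) \<le> C * (b - a)"
proof -
  have "C1_on \<alpha> a b" unfolding C1_on_def using D has_vector_derivative_at_within by blast
  then have pc: "piecewise_C1_on \<alpha> a b" by (rule C1_on_imp_piecewise_C1_on[OF \<open>a \<le> b\<close>])
  have "kobayashi_length G \<alpha> a b \<le> C * (b - a)"
  proof (rule kobayashi_length_le[OF G pc im])
    fix t assume "t \<in> {a<..<b}"
    then have "t \<in> {a..b}" by simp
    then show "kobayashi_speed G \<alpha> t \<le> C"
      using C[of t] vector_derivative_at[OF D(1), of t] by simp
  qed
  then show ?thesis using kobayashi_dist_le_length[OF G pc im] by linarith
qed

lemma kobayashi_dist_le_segment:
  fixes G :: "(complex ^ 'n) set"
  assumes G: "open G" and "\<delta> > 0" and seg: "\<And>x. x \<in> closed_segment z w \<Longrightarrow> ball x \<delta> \<subseteq> G"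
  shows "kobayashi_dist G z w \<le> norm (w - z) / \<delta>"
proof -
  let ?\<alpha> = "\<lambda>t. z + t *\<^sub>R (w - z)"
  have mem: "?\<alpha> t \<in> closed_segment z w" if "t \<in> {0..1}" for t
    using that unfolding in_segment by (intro exI[of _ t]) (auto simp: algebra_simps)
  have "kobayashi_dist G (?\<alpha> 0) (?\<alpha> 1) \<le> norm (w - z) / \<delta> * (1 - 0)"
  proof (rule kobayashi_dist_le_smooth[OF G, where D = "\<lambda>_. w - z"])
    show "?\<alpha> ` {0..1} \<subseteq> G" using mem seg \<open>\<delta> > 0\<close> by (fastforce simp del: closed_segment_def)
    show "(?\<alpha> has_vector_derivative w - z) (at t)" for t
      by (auto intro!: derivative_eq_intros)
    show "kobayashi_metric G (?\<alpha> t) (w - z) \<le> norm (w - z) / \<delta>" if "t \<in> {0..1}" for t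
      by (rule kobayashi_metric_le_norm[OF seg[OF mem[OF that]] \<open>\<delta> > 0\<close>])
  qed auto
  then show ?thesis by simp
qed

text \<open>By the triangle inequality it suffices that \<open>k(z, w)\<close> tends to 0 as \<open>w\<close> tends to \<open>z\<close>, which
  the segment from \<open>z\<close> to \<open>w\<close> shows.\<close>

lemma kobayashi_dist_continuous:
  fixes G :: "(complex ^ 'n) set"
  assumes G: "open G" "connected G"
  shows "continuous_on (G \<times> G) (\<lambda>(x, y). kobayashi_dist G x y)"
proof -
  have small: "\<exists>d>0. \<forall>w. dist w z < d \<longrightarrow> w \<in> G \<and> kobayashi_dist G z w < e" if z: "z \<in> G" and "e > 0" for z e
  proof -
    obtain r where r: "r > 0" "ball z r \<subseteq> G" using G(1) z openE by blast
    have *: "w \<in> G \<and> kobayashi_dist G z w < e" if w: "dist w z < min (r/2) (r * e / 2)" for w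
    proof
      show "w \<in> G" using w r by (auto simp: dist_commute subset_iff)
      have "closed_segment z w \<subseteq> ball z (r/2)"
        by (rule closed_segment_subset) (use w r in \<open>auto simp: dist_commute\<close>)
      then have "ball x (r/2) \<subseteq> G" if "x \<in> closed_segment z w" for x
        using that r(2) by (auto simp: subset_iff) (smt (verit) dist_triangle field_sum_of_halves)
      then have "kobayashi_dist G z w \<le> norm (w - z) / (r/2)"
        using r(1) by (intro kobayashi_dist_le_segment[OF G(1)]) auto
      also have "\<dots> < e" using w r(1) by (simp add: dist_norm field_simps)
      finally show "kobayashi_dist G z w < e" .
    qed
    show ?thesis
      by (rule exI[of _ "min (r/2) (r * e / 2)"]) (use * r(1) \<open>e > 0\<close> in auto)
  qed
  show ?thesis
    unfolding continuous_on_iff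
  proof (intro ballI allI impI)
    fix x :: "(complex ^ 'n) \<times> (complex ^ 'n)" and e :: real
    assume x: "x \<in> G \<times> G" and "0 < e"
    then have e2: "e/2 > 0" by simp
    obtain z w where zw: "x = (z, w)" "z \<in> G" "w \<in> G" using x by auto
    obtain d1 where d1: "d1 > 0" "\<And>v. dist v z < d1 \<Longrightarrow> v \<in> G \<and> kobayashi_dist G z v < e/2"
      using small[OF zw(2) e2] by blast
    obtain d2 where d2: "d2 > 0" "\<And>v. dist v w < d2 \<Longrightarrow> v \<in> G \<and> kobayashi_dist G w v < e/2"
      using small[OF zw(3) e2] by blast
    have "dist (kobayashi_dist G z' w') (kobayashi_dist G z w) < e"
      if a: "z' \<in> G" "w' \<in> G" "dist (z', w') (z, w) < min d1 d2" for z' w'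
    proof -
      have "dist z' z < d1" "dist w' w < d2"
        using a(3) dist_fst_le[of "(z', w')" "(z, w)"] dist_snd_le[of "(z', w')" "(z, w)"] by auto
      then have "kobayashi_dist G z z' < e/2" "kobayashi_dist G w w' < e/2" using d1 d2 by auto
      moreover have "kobayashi_dist G z' w' \<le> kobayashi_dist G z' z + kobayashi_dist G z w + kobayashi_dist G w w'"
        using kobayashi_dist_triangle[OF G, of z' z w'] kobayashi_dist_triangle[OF G, of z w w'] a zw by simp
      moreover have "kobayashi_dist G z w \<le> kobayashi_dist G z z' + kobayashi_dist G z' w' + kobayashi_dist G w' w"
        using kobayashi_dist_triangle[OF G, of z z' w] kobayashi_dist_triangle[OF G, of z' w' w] a zw by simp
      moreover have "kobayashi_dist G z' z = kobayashi_dist G z z'" "kobayashi_dist G w' w = kobayashi_dist G w w'"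
        using kobayashi_dist_commute[OF G] a zw by auto
      ultimately show ?thesis by (simp add: dist_real_def)
    qed
    then show "\<exists>d>0. \<forall>x'\<in>G \<times> G. dist x' x < d \<longrightarrow>
        dist (case x' of (x, y) \<Rightarrow> kobayashi_dist G x y) (case x of (x, y) \<Rightarrow> kobayashi_dist G x y) < e"
      by (intro exI[of _ "min d1 d2"]) (use d1(1) d2(1) zw(1) in auto)
  qed
qed

section \<open>Lower bounds from positive pluriharmonic functions\<close>

text \<open>The bilinear pairing (without conjugation), so that \<open>cdot a\<close> is the general complex linear
  functional.\<close>

definition cdot :: "complex ^ 'n \<Rightarrow> complex ^ 'n \<Rightarrow> complex" where
  "cdot a z = (\<Sum>i\<in>UNIV. a $ i * z $ i)"

lemma cdot_add: "cdot a (x + y) = cdot a x + cdot a y"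
  by (simp add: cdot_def algebra_simps sum.distrib)

lemma cdot_cscale: "cdot a (c *s x) = c * cdot a x"
  by (simp add: cdot_def sum_distrib_left algebra_simps)

lemma cdot_scaleR: "cdot a (r *\<^sub>R x) = of_real r * cdot a x"
  by (simp add: scaleR_eq_cscale cdot_cscale)

lemma cdot_diff: "cdot a (x - y) = cdot a x - cdot a y"
  using cdot_add[of a "x - y" y] by simp

lemma continuous_on_cdot [continuous_intros]: "continuous_on S (cdot a)"
  unfolding cdot_def by (intro continuous_intros)

lemma norm_cdot_le: "cmod (cdot a z) \<le> (\<Sum>i\<in>UNIV. cmod (a $ i)) * norm z"
  unfolding cdot_def sum_distrib_right
  by (rule sum_norm_le) (simp add: norm_mult mult_left_mono Finite_Cartesian_Product.norm_nth_le)

lemma Re_cdot_cnj: "Re (cdot (\<chi> i. cnj (a $ i)) z) = a \<bullet> z"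
  by (simp add: cdot_def inner_vec_def inner_complex_def)

lemma cdot_surj:
  assumes "a \<noteq> 0" obtains v where "cdot a v = 1"
proof -
  obtain i where "a $ i \<noteq> 0" using assms by (auto simp: vec_eq_iff)
  then have "cdot a (axis i (1 / a $ i)) = 1"
    by (simp add: cdot_def axis_def if_distrib[of "\<lambda>x. _ * x"] cong: if_cong)
  then show ?thesis by (rule that)
qed

lemma cdot_kernel:
  fixes a :: "complex ^ 'n"
  assumes "CARD('n) \<ge> 2" obtains w where "w \<noteq> 0" "cdot a w = 0"
proof (cases "a = 0")
  case True
  then show ?thesis using that[of 1] by (simp add: cdot_def)
next
  case False
  then obtain i where i: "a $ i \<noteq> 0" by (auto simp: vec_eq_iff)
  have "\<exists>j. j \<noteq> i"
  proof (rule ccontr)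
    assume "\<not> (\<exists>j. j \<noteq> i)"
    then have "(UNIV :: 'n set) = {i}" by auto
    then have "CARD('n) = card {i}" by (rule arg_cong)
    then show False using assms by simp
  qed
  then obtain j where j: "j \<noteq> i" ..
  define w :: "complex ^ 'n" where "w = axis j (a $ i) + axis i (- (a $ j))"
  have "w $ j \<noteq> 0" using i j by (simp add: w_def axis_def)
  then have "w \<noteq> 0" by (metis zero_index)
  moreover have "cdot a w = 0"
    unfolding w_def cdot_add
    by (simp add: cdot_def axis_def if_distrib[of "\<lambda>x. _ * x"] cong: if_cong)
  ultimately show ?thesis by (rule that)
qed

text \<open>The Cayley transform that sends \<open>g 0\<close> to 0 maps the right half plane into the unit disc, where
  the Schwarz lemma applies.\<close>

lemma Schwarz_Pick_half_plane:
  assumes "g holomorphic_on ball 0 1" and pos: "\<And>\<zeta>. cmod \<zeta> < 1 \<Longrightarrow> 0 < Re (g \<zeta>)"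
  shows "cmod (deriv g 0) \<le> 2 * Re (g 0)"
proof -
  define w where "w = g 0"
  have w: "Re w > 0" using pos[of 0] by (simp add: w_def)
  define F where "F = (\<lambda>\<zeta>. (g \<zeta> - w) / (g \<zeta> + cnj w))"
  have nz: "g \<zeta> + cnj w \<noteq> 0" if "cmod \<zeta> < 1" for \<zeta>
    using pos[OF that] w by (auto simp: complex_eq_iff)
  have holF: "F holomorphic_on ball 0 1"
    unfolding F_def by (intro holomorphic_intros assms) (use nz in auto)
  have F1: "cmod (F \<zeta>) < 1" if "cmod \<zeta> < 1" for \<zeta>
  proof -
    have "(cmod (g \<zeta> - w))\<^sup>2 < (cmod (g \<zeta> + cnj w))\<^sup>2"
      using mult_pos_pos[OF pos[OF that] w] unfolding cmod_power2 by (simp add: power2_eq_square algebra_simps)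
    then have "cmod (g \<zeta> - w) < cmod (g \<zeta> + cnj w)" by (rule power2_less_imp_less) simp
    then show ?thesis using nz[OF that] by (simp add: F_def norm_divide)
  qed
  have dg: "(g has_field_derivative deriv g 0) (at 0)"
    by (rule holomorphic_derivI[OF assms(1)]) auto
  have nz0: "w + cnj w \<noteq> 0" using nz[of 0] by (simp add: w_def)
  have "(F has_field_derivative deriv g 0 / (w + cnj w)) (at 0)"
    unfolding F_def using dg nz0
    by (auto intro!: derivative_eq_intros simp: w_def)
  then have dF: "deriv F 0 = deriv g 0 / (w + cnj w)" by (rule DERIV_imp_deriv)
  have "cmod (deriv F 0) \<le> 1"
    by (rule Schwarz_Lemma(2)[OF holF _ F1, of 0]) (auto simp: F_def w_def)
  moreover have "w + cnj w = of_real (2 * Re w)" by (simp add: complex_add_cnj)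
  ultimately have "cmod (deriv g 0) / (2 * Re w) \<le> 1"
    using w unfolding dF norm_divide by (simp add: norm_mult)
  then show ?thesis using w by (simp add: w_def[symmetric] field_simps)
qed

text \<open>A weak form of pluriharmonicity with exactly what the Schwarz--Pick argument consumes: along
  every holomorphic disc the function is the real part of a holomorphic function.\<close>

definition pos_pluriharmonic :: "(complex ^ 'n) set \<Rightarrow> (complex ^ 'n \<Rightarrow> real) \<Rightarrow> bool" where
  "pos_pluriharmonic G h \<longleftrightarrow>
     (\<forall>z\<in>G. 0 < h z \<and> h differentiable (at z)) \<and>
     (\<forall>f. holomorphic_disc G f \<longrightarrow>
        (\<exists>g. g holomorphic_on ball 0 1 \<and> (\<forall>\<zeta>\<in>ball 0 1. Re (g \<zeta>) = h (f \<zeta>))))"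

text \<open>Restrict \<open>h\<close> to a competing disc \<open>f\<close>: with \<open>h \<circ> f = Re g\<close> the derivative of \<open>h\<close> in the
  direction \<open>X = l f'(0)\<close> is \<open>Re (l g'(0))\<close>, and \<open>\<bar>g'(0)\<bar> \<le> 2 Re (g 0) = 2 h(z)\<close>.\<close>

lemma pos_pluriharmonic_derivative_le:
  fixes z X :: "complex ^ 'n"
  assumes "open G" "z \<in> G" and h: "pos_pluriharmonic G h" and h': "(h has_derivative h') (at z)"
  shows "\<bar>h' X\<bar> \<le> 2 * h z * kobayashi_metric G z X"
proof -
  have hz: "h z > 0" using h assms by (auto simp: pos_pluriharmonic_def)
  have "\<bar>h' X\<bar> / (2 * h z) \<le> kobayashi_metric G z X"
  proof (rule kobayashi_metric_ge[OF assms(1,2)])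
    fix f l assume f: "holomorphic_disc G f" "f 0 = z" "l *s disc_tangent f = X"
    obtain g where g: "g holomorphic_on ball 0 1" "\<And>\<zeta>. cmod \<zeta> < 1 \<Longrightarrow> Re (g \<zeta>) = h (f \<zeta>)"
      using h f by (auto simp: pos_pluriharmonic_def)
    have line: "((\<lambda>t. of_real t * l) has_vector_derivative l) (at 0)"
      by (auto intro!: derivative_eq_intros)
    have chain: "((\<lambda>t. u (of_real t * l)) has_vector_derivative l * deriv u 0) (at 0)"
      if "u holomorphic_on ball 0 1" for u :: "complex \<Rightarrow> complex"
    proof -
      have "(u has_field_derivative deriv u 0) (at (of_real 0 * l))"
        using holomorphic_derivI[OF that, of 0 UNIV] by simp
      from field_vector_diff_chain_at[OF line this] show ?thesis by (simp add: o_def)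
    qed
    have "((\<lambda>t. f (of_real t * l)) has_vector_derivative X) (at 0)"
    proof (rule has_vector_derivative_vecI)
      fix i
      have "(\<lambda>\<zeta>. f \<zeta> $ i) holomorphic_on ball 0 1" using f by (auto simp: holomorphic_disc_def)
      from chain[OF this] show "((\<lambda>t. f (of_real t * l) $ i) has_vector_derivative X $ i) (at 0)"
        by (simp add: f(3)[symmetric])
    qed
    then have A: "((\<lambda>t. h (f (of_real t * l))) has_vector_derivative h' X) (at 0)"
      using vector_derivative_diff_chain_within[of "\<lambda>t. f (of_real t * l)" X 0 UNIV h h'] h' f(2)
      by (auto simp: o_def intro: has_derivative_at_withinI)
    have B: "((\<lambda>t. Re (g (of_real t * l))) has_vector_derivative Re (l * deriv g 0)) (at 0)"
      by (rule bounded_linear.has_vector_derivative[OF bounded_linear_Re chain[OF g(1)]])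
    have "((\<lambda>t. cmod (of_real t * l)) \<longlongrightarrow> cmod (of_real 0 * l)) (at 0)"
      by (intro tendsto_intros)
    then have "eventually (\<lambda>t. cmod (of_real t * l) < 1) (at 0)"
      by (rule order_tendstoD) auto
    then have "eventually (\<lambda>t. Re (g (of_real t * l)) = h (f (of_real t * l))) (at 0)"
      by eventually_elim (rule g(2))
    then have "((\<lambda>t. h (f (of_real t * l))) has_vector_derivative Re (l * deriv g 0)) (at 0)"
      unfolding has_vector_derivative_def
      by (rule has_derivative_transform_eventually[OF B[unfolded has_vector_derivative_def]])
         (use g(2)[of 0] in auto)
    from vector_derivative_unique_at[OF this A] have "\<bar>h' X\<bar> = \<bar>Re (l * deriv g 0)\<bar>" by simp
    also have "\<dots> \<le> cmod l * cmod (deriv g 0)"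
      using abs_Re_le_cmod[of "l * deriv g 0"] by (simp add: norm_mult)
    also have "\<dots> \<le> cmod l * (2 * Re (g 0))"
      by (rule mult_left_mono[OF Schwarz_Pick_half_plane[OF g(1)] norm_ge_zero])
         (use h f(1) g(2) in \<open>auto simp: pos_pluriharmonic_def holomorphic_disc_def image_subset_iff\<close>)
    also have "2 * Re (g 0) = 2 * h z" using g(2)[of 0] f(2) by simp
    finally show "\<bar>h' X\<bar> / (2 * h z) \<le> cmod l"
      using hz by (simp add: field_simps)
  qed
  then show ?thesis using hz by (simp add: field_simps)
qed

lemma pos_pluriharmonic_Re_affine:
  fixes a :: "complex ^ 'n"
  assumes "\<And>z. z \<in> G \<Longrightarrow> 0 < Re (cdot a z - b)"
  shows "pos_pluriharmonic G (\<lambda>z. Re (cdot a z - b))"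
  unfolding pos_pluriharmonic_def
proof (intro conjI ballI allI impI)
  show "(\<lambda>z. Re (cdot a z - b)) differentiable at z" for z
    unfolding differentiable_def cdot_def
    by (rule exI, rule bounded_linear.has_derivative[OF bounded_linear_Re], 
       (rule derivative_intros bounded_linear.has_derivative[OF bounded_linear_vec_nth])+)
next
  fix f assume "holomorphic_disc G f"
  then have "(\<lambda>\<zeta>. cdot a (f \<zeta>) - b) holomorphic_on ball 0 1"
    unfolding cdot_def holomorphic_disc_def by (intro holomorphic_intros) auto
  then show "\<exists>g. g holomorphic_on ball 0 1 \<and> (\<forall>\<zeta>\<in>ball 0 1. Re (g \<zeta>) = Re (cdot a (f \<zeta>) - b))"
    by blast
qed (use assms in auto)

text \<open>The zero-free function \<open>u \<circ> f\<close> has a holomorphic logarithm \<open>g\<close> on the disc, and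
  \<open>ln (R / \<bar>u \<circ> f\<bar>) = Re (ln R - g)\<close>. Half the logarithm of this function is the height in the cusp of the
  punctured disc of radius \<open>R\<close>.\<close>

lemma pos_pluriharmonic_log_affine:
  fixes a :: "complex ^ 'n" and b :: complex
  defines "u \<equiv> \<lambda>z. cdot a z - b"
  assumes "\<And>z. z \<in> G \<Longrightarrow> u z \<noteq> 0" "\<And>z. z \<in> G \<Longrightarrow> cmod (u z) < R" 
  shows "pos_pluriharmonic G (\<lambda>z. ln (R / cmod (u z)))"
  unfolding pos_pluriharmonic_def
proof (intro conjI ballI allI impI)
  fix z assume z: "z \<in> G"
  show "0 < ln (R / cmod (u z))" using assms(2,3)[OF z] by (intro ln_gt_zero) (simp add: field_simps)
  have R: "R > 0" using assms(3)[OF z] by (smt (verit) norm_ge_zero)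
  have d: "u differentiable at z"
    unfolding differentiable_def u_def cdot_def
    by (rule exI, (rule derivative_intros bounded_linear.has_derivative[OF bounded_linear_vec_nth])+)
  have "(\<lambda>z. cmod (u z)) differentiable at z"
    by (rule differentiable_compose[OF differentiable_norm_at d]) (use assms(2)[OF z] in auto)
  then obtain D where D: "((\<lambda>z. cmod (u z)) has_derivative D) (at z)" by (auto simp: differentiable_def)
  show "(\<lambda>z. ln (R / cmod (u z))) differentiable at z"
    unfolding differentiable_def
    by (rule exI, rule has_derivative_ln, use assms(2)[OF z] R in simp, rule has_derivative_divide[OF has_derivative_const D])
       (use assms(2)[OF z] in simp)
next
  fix f assume f: "holomorphic_disc G f"
  have hol: "(\<lambda>\<zeta>. u (f \<zeta>)) holomorphic_on ball 0 1"
    using f unfolding u_def cdot_def by (intro holomorphic_intros) (auto simp: holomorphic_disc_def)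
  have fG: "f \<zeta> \<in> G" if "\<zeta> \<in> ball 0 1" for \<zeta> using f that by (auto simp: holomorphic_disc_def)
  obtain g where g: "g holomorphic_on ball 0 1" "\<And>\<zeta>. \<zeta> \<in> ball 0 1 \<Longrightarrow> u (f \<zeta>) = exp (g \<zeta>)"
    using holomorphic_logarithm_exists[OF convex_ball open_ball hol, of 0] fG assms(2)
    by (smt (verit) centre_in_ball zero_less_one)
  show "\<exists>g. g holomorphic_on ball 0 1 \<and> (\<forall>\<zeta>\<in>ball 0 1. Re (g \<zeta>) = ln (R / cmod (u (f \<zeta>))))"
  proof (intro exI[of _ "\<lambda>\<zeta>. of_real (ln R) - g \<zeta>"] conjI ballI)
    show "(\<lambda>\<zeta>. of_real (ln R) - g \<zeta>) holomorphic_on ball 0 1" by (intro holomorphic_intros g)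
    fix \<zeta> :: complex assume z: "\<zeta> \<in> ball 0 1"
    have R: "R > 0" using assms(3)[OF fG[OF z]] by (smt (verit) norm_ge_zero)
    then show "Re (of_real (ln R) - g \<zeta>) = ln (R / cmod (u (f \<zeta>)))"
      by (simp add: g(2)[OF z] ln_div)
  qed
qed

text \<open>The derivative of \<open>ln h / 2\<close> along the curve is at most its speed; integrate over each piece.\<close>

lemma ln_pos_pluriharmonic_le_length:
  fixes G :: "(complex ^ 'n) set"
  assumes G: "open G" and h: "pos_pluriharmonic G h"
  shows "piecewise_C1_on \<alpha> a b \<Longrightarrow> \<alpha> ` {a..b} \<subseteq> G \<Longrightarrow> (ln (h (\<alpha> b)) - ln (h (\<alpha> a))) / 2 \<le> kobayashi_length G \<alpha> a b"
proof (induction rule: piecewise_C1_on.induct)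
  case (refl a)
  then show ?case using kobayashi_length_nonneg[OF G, of \<alpha> a a] by simp
next
  case (step a b c)
  have ab: "a \<le> b" using step piecewise_C1_on_le by blast
  have im: "\<alpha> ` {b..c} \<subseteq> G" using step ab by auto
  have imt: "\<alpha> t \<in> G" if "t \<in> {b..c}" for t using im that by blast
  obtain D where D: "\<And>t. t \<in> {b..c} \<Longrightarrow> (\<alpha> has_vector_derivative D t) (at t within {b..c})"
    using step.hyps(3) unfolding C1_on_def by blast
  have "\<exists>h'. (h has_derivative h') (at z)" if "z \<in> G" for z
    using h that by (auto simp: pos_pluriharmonic_def differentiable_def)
  then obtain h' where h': "\<And>z. z \<in> G \<Longrightarrow> (h has_derivative h' z) (at z)" by metis
  have pos: "h z > 0" if "z \<in> G" for z using h that by (auto simp: pos_pluriharmonic_def)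
  let ?u = "\<lambda>t. ln (h (\<alpha> t)) / 2" and ?u' = "\<lambda>t. h' (\<alpha> t) (D t) / (2 * h (\<alpha> t))"
  have "(?u has_vector_derivative ?u' t) (at t within {b..c})" if t: "t \<in> {b..c}" for t
  proof -
    have "((h \<circ> \<alpha>) has_vector_derivative h' (\<alpha> t) (D t)) (at t within {b..c})"
      by (rule vector_derivative_diff_chain_within[OF D[OF t]])
         (rule has_derivative_at_withinI[OF h'[OF imt[OF t]]])
    then have "((\<lambda>t. h (\<alpha> t)) has_real_derivative h' (\<alpha> t) (D t)) (at t within {b..c})"
      by (simp add: has_real_derivative_iff_has_vector_derivative o_def)
    from DERIV_cdivide[OF DERIV_chain2[OF DERIV_ln[OF pos[OF imt[OF t]]] this], of 2]
    have "(?u has_real_derivative ?u' t) (at t within {b..c})"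
      by (simp add: field_simps)
    then show ?thesis by (simp add: has_real_derivative_iff_has_vector_derivative)
  qed
  then have "(?u' has_integral (?u c - ?u b)) {b..c}"
    by (intro fundamental_theorem_of_calculus) (use step in auto)
  then have 1: "(?u' has_integral (?u c - ?u b)) {b<..<c}" by (simp add: has_integral_Icc_iff_Ioo)
  have 2: "(kobayashi_speed G \<alpha> has_integral kobayashi_length G \<alpha> b c) {b<..<c}"
    unfolding has_integral_Icc_iff_Ioo[symmetric] kobayashi_length_def
    by (rule integrable_integral, rule C1_on_speed_integrable[OF G step.hyps(3) im])
  have "?u c - ?u b \<le> kobayashi_length G \<alpha> b c"
  proof (rule has_integral_le[OF 1 2])
    fix t assume t: "t \<in> {b<..<c}"
    then have t': "t \<in> {b..c}" by simp
    have "(\<alpha> has_vector_derivative D t) (at t)" using D[OF t'] t by (simp add: at_within_Icc_at)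
    then have "vector_derivative \<alpha> (at t) = D t" by (rule vector_derivative_at)
    moreover have "\<bar>h' (\<alpha> t) (D t)\<bar> \<le> 2 * h (\<alpha> t) * kobayashi_metric G (\<alpha> t) (D t)"
      by (rule pos_pluriharmonic_derivative_le[OF G imt[OF t'] h h'[OF imt[OF t']]])
    ultimately show "?u' t \<le> kobayashi_speed G \<alpha> t"
      using pos[OF imt[OF t']] by (simp add: field_simps)
  qed
  moreover have "kobayashi_length G \<alpha> a c = kobayashi_length G \<alpha> a b + kobayashi_length G \<alpha> b c"
    by (rule kobayashi_length_split[symmetric, OF G])
       (use step ab in \<open>auto intro: piecewise_C1_on.step\<close>)
  moreover have "(ln (h (\<alpha> b)) - ln (h (\<alpha> a))) / 2 \<le> kobayashi_length G \<alpha> a b"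
    by (rule step.IH) (use step in auto)
  ultimately show ?case by (simp add: field_simps)
qed

lemma ln_pos_pluriharmonic_le_dist:
  fixes G :: "(complex ^ 'n) set"
  assumes G: "open G" "connected G" and h: "pos_pluriharmonic G h" and pq: "p \<in> G" "q \<in> G"
  shows "\<bar>ln (h p) - ln (h q)\<bar> \<le> 2 * kobayashi_dist G p q"
proof -
  have *: "ln (h y) - ln (h x) \<le> 2 * kobayashi_dist G x y" if "x \<in> G" "y \<in> G" for x y
  proof (rule field_le_epsilon)
    fix e :: real assume "e > 0"
    then have e: "e/2 > 0" by simp
    obtain \<alpha> where a: "piecewise_C1_on \<alpha> 0 1" "\<alpha> ` {0..1} \<subseteq> G" "\<alpha> 0 = x" "\<alpha> 1 = y"
        "kobayashi_length G \<alpha> 0 1 < kobayashi_dist G x y + e/2"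
      using kobayashi_dist_almost_attained[OF G \<open>x \<in> G\<close> \<open>y \<in> G\<close> e] by metis
    then show "ln (h y) - ln (h x) \<le> 2 * kobayashi_dist G x y + e"
      using ln_pos_pluriharmonic_le_length[OF G(1) h a(1,2)] by (simp add: field_simps)
  qed
  show ?thesis
    using *[OF pq] *[OF pq(2,1)] kobayashi_dist_commute[OF G pq] by linarith
qed

section \<open>Existence of geodesics\<close>

text \<open>Tychonoff's theorem in the function space.\<close>

lemma compact_function_space:
  assumes "compact (K :: 'b::topological_space set)"
  shows "compact {\<gamma> :: 'a \<Rightarrow> 'b. \<forall>t. \<gamma> t \<in> K}"
proof -
  have "compactin (product_topology (\<lambda>_::'a. euclidean) UNIV) (PiE UNIV (\<lambda>_. K))"
    using assms by (simp add: compactin_PiE)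
  moreover have "PiE UNIV (\<lambda>_. K) = {\<gamma> :: 'a \<Rightarrow> 'b. \<forall>t. \<gamma> t \<in> K}" by auto
  ultimately show ?thesis by (simp add: euclidean_product_topology)
qed

text \<open>The \<open>e\<close>-almost geodesics form a non-empty closed subset of the compact space of all functions
  into \<open>K\<close>, decreasing with \<open>e\<close>. A common point for all \<open>e > 0\<close> is a geodesic. Pointwise convergence is
  enough, since the defining condition involves only two parameters at a time.\<close>

lemma geodesic_of_almost_geodesics:
  fixes d :: "'a::metric_space \<Rightarrow> 'a \<Rightarrow> real"
  assumes K: "compact K" "K \<subseteq> X" and cont: "continuous_on (K \<times> K) (\<lambda>(x, y). d x y)" and "0 \<le> L"
    and almost: "\<And>e. e > 0 \<Longrightarrow> \<exists>\<gamma>. (\<forall>t. \<gamma> t \<in> K) \<and> \<gamma> 0 = p \<and> \<gamma> L = q \<and>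
        (\<forall>s\<in>{0..L}. \<forall>t\<in>{0..L}. \<bar>d (\<gamma> s) (\<gamma> t) - \<bar>s - t\<bar>\<bar> \<le> e)"
  shows "\<exists>A. geodesic_segment X d p q A"
proof -
  define P where "P = {\<gamma> :: real \<Rightarrow> 'a. \<forall>t. \<gamma> t \<in> K}"
  have P: "compact P" "closed P"
  proof -
    show "compact P" unfolding P_def by (rule compact_function_space[OF K(1)])
    have "P = (\<Inter>t. (\<lambda>\<gamma>. \<gamma> t) -` K)" by (auto simp: P_def)
    moreover have "closed ((\<lambda>\<gamma> :: real \<Rightarrow> 'a. \<gamma> t) -` K)" for t
      using continuous_closed_preimage[OF continuous_on_product_coordinates[of t] closed_UNIV compact_imp_closed[OF K(1)]]
      by simp
    ultimately show "closed P" by auto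
  qed
  define \<epsilon> where "\<epsilon> = (\<lambda>n :: nat. inverse (real (Suc n)))"
  define C where "C = (\<lambda>n :: nat. {\<gamma> \<in> P. \<gamma> 0 = p \<and> \<gamma> L = q \<and>
        (\<forall>s\<in>{0..L}. \<forall>t\<in>{0..L}. d (\<gamma> s) (\<gamma> t) \<in> {\<bar>s - t\<bar> - \<epsilon> n..\<bar>s - t\<bar> + \<epsilon> n})})"
  have absiff: "\<bar>x - y\<bar> \<le> e \<longleftrightarrow> x \<in> {y - e..y + e}" for x y e :: real by auto
  have coord: "closed (P \<inter> (\<lambda>\<gamma>. \<gamma> s) -` {x})" for s x
    by (rule continuous_closed_preimage[OF _ P(2)])
       (auto intro: continuous_on_subset[OF continuous_on_product_coordinates])
  have dist: "closed (P \<inter> (\<lambda>\<gamma>. d (\<gamma> s) (\<gamma> t)) -` {\<bar>s - t\<bar> - e..\<bar>s - t\<bar> + e})" for s t e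
  proof (rule continuous_closed_preimage[OF _ P(2) closed_atLeastAtMost])
    have "continuous_on P (\<lambda>\<gamma>. (\<gamma> s, \<gamma> t))"
      by (intro continuous_on_Pair) (auto intro: continuous_on_subset[OF continuous_on_product_coordinates])
    moreover have "(\<lambda>\<gamma>. (\<gamma> s, \<gamma> t)) ` P \<subseteq> K \<times> K" by (auto simp: P_def)
    ultimately have "continuous_on P (\<lambda>\<gamma>. case (\<gamma> s, \<gamma> t) of (x, y) \<Rightarrow> d x y)"
      by (rule continuous_on_compose2[OF cont])
    then show "continuous_on P (\<lambda>\<gamma>. d (\<gamma> s) (\<gamma> t))" by simp
  qed
  have closed: "closed (C n)" for n
  proof -
    have "C n = (P \<inter> (\<lambda>\<gamma>. \<gamma> 0) -` {p}) \<inter> (P \<inter> (\<lambda>\<gamma>. \<gamma> L) -` {q}) \<inter>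
      (\<Inter>s\<in>{0..L}. \<Inter>t\<in>{0..L}. P \<inter> (\<lambda>\<gamma>. d (\<gamma> s) (\<gamma> t)) -` {\<bar>s - t\<bar> - \<epsilon> n..\<bar>s - t\<bar> + \<epsilon> n})"
      using \<open>0 \<le> L\<close> unfolding C_def by (intro set_eqI) (simp del: atLeastAtMost_iff, blast)
    moreover have "closed \<dots>"
      by (intro closed_Int[OF closed_Int] closed_INT ballI coord dist)
    ultimately show ?thesis by simp
  qed
  have "P \<inter> \<Inter> (range C) \<noteq> {}"
  proof (rule compact_imp_fip[OF P(1)])
    fix F assume F: "finite F" "F \<subseteq> range C"
    then obtain I where I: "finite I" "F = C ` I" by (meson finite_subset_image)
    define n where "n = Max (insert 0 I)"
    have n: "i \<le> n" if "i \<in> I" for i using I(1) that by (simp add: n_def)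
    have "\<epsilon> n > 0" by (simp add: \<epsilon>_def)
    from almost[OF this] obtain \<gamma> where "\<forall>t. \<gamma> t \<in> K" "\<gamma> 0 = p" "\<gamma> L = q"
      "\<forall>s\<in>{0..L}. \<forall>t\<in>{0..L}. \<bar>d (\<gamma> s) (\<gamma> t) - \<bar>s - t\<bar>\<bar> \<le> \<epsilon> n" by blast
    then have g: "\<gamma> \<in> C n" unfolding C_def P_def absiff by blast
    have "C n \<subseteq> C i" if "i \<in> I" for i
    proof -
      have "\<epsilon> n \<le> \<epsilon> i" using n[OF that] by (simp add: \<epsilon>_def)
      then show ?thesis unfolding C_def by fastforce
    qed
    then have "\<gamma> \<in> \<Inter> F" using g I(2) by blast
    moreover have "\<gamma> \<in> P" using g by (simp add: C_def)
    ultimately show "P \<inter> \<Inter> F \<noteq> {}" by blast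
  qed (use closed in auto)
  then obtain \<gamma> where g: "\<And>n. \<gamma> \<in> C n" by auto
  have "d (\<gamma> s) (\<gamma> t) = \<bar>s - t\<bar>" if "s \<in> {0..L}" "t \<in> {0..L}" for s t
  proof -
    have "\<bar>d (\<gamma> s) (\<gamma> t) - \<bar>s - t\<bar>\<bar> \<le> 0 + e" if "e > 0" for e
    proof -
      obtain n where "\<epsilon> n < e" using reals_Archimedean[OF \<open>e > 0\<close>] by (auto simp: \<epsilon>_def)
      moreover have "\<bar>d (\<gamma> s) (\<gamma> t) - \<bar>s - t\<bar>\<bar> \<le> \<epsilon> n"
        using g[of n] \<open>s \<in> {0..L}\<close> \<open>t \<in> {0..L}\<close> unfolding absiff by (simp add: C_def)
      ultimately show ?thesis by linarith
    qed
    then have "\<bar>d (\<gamma> s) (\<gamma> t) - \<bar>s - t\<bar>\<bar> \<le> 0" by (rule field_le_epsilon)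
    then show ?thesis by simp
  qed
  moreover have "\<gamma> 0 = p" "\<gamma> L = q" "\<gamma> ` {0..L} \<subseteq> X" using g[of 0] K(2) by (auto simp: C_def P_def)
  ultimately have "geodesic X d 0 L \<gamma>" using \<open>0 \<le> L\<close> by (simp add: geodesic_def)
  then show ?thesis unfolding geodesic_segment_def using \<open>\<gamma> 0 = p\<close> \<open>\<gamma> L = q\<close> by blast
qed

text \<open>Take a curve of length less than \<open>L + e / 2\<close> and parametrise it by length. Every subarc is almost
  as short as possible, since the lengths of the complementary arcs together with the distance of its end
  points add up to at least \<open>L\<close>.\<close>

lemma kobayashi_almost_geodesic:
  fixes G :: "(complex ^ 'n) set"
  assumes G: "open G" "connected G" and pq: "p \<in> G" "q \<in> G" and "e > 0"
  defines "L \<equiv> kobayashi_dist G p q"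
  assumes "L > 0"
  obtains \<gamma> where "\<gamma> 0 = p" "\<gamma> L = q" "\<And>t. t \<in> {0..L} \<Longrightarrow> \<gamma> t \<in> G"
    "\<And>s t. s \<in> {0..L} \<Longrightarrow> t \<in> {0..L} \<Longrightarrow> \<bar>kobayashi_dist G (\<gamma> s) (\<gamma> t) - \<bar>s - t\<bar>\<bar> \<le> e"
proof -
  let ?d = "kobayashi_dist G"
  have e2: "e/2 > 0" using \<open>e > 0\<close> by simp
  obtain \<alpha> where a: "piecewise_C1_on \<alpha> 0 1" "\<alpha> ` {0..1} \<subseteq> G" "\<alpha> 0 = p" "\<alpha> 1 = q"
      "kobayashi_length G \<alpha> 0 1 < L + e/2"
    using kobayashi_dist_almost_attained[OF G pq e2] unfolding L_def by metis
  define F where "F = kobayashi_length G \<alpha> 0"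
  have part: "?d (\<alpha> x) (\<alpha> y) \<le> F y - F x" if "0 \<le> x" "x \<le> y" "y \<le> 1" for x y
  proof -
    have y: "piecewise_C1_on \<alpha> 0 y" using piecewise_C1_on_initial[OF a(1), of y] that by simp
    have im: "\<alpha> ` {0..y} \<subseteq> G" "\<alpha> ` {x..y} \<subseteq> G" using a(2) that by auto
    have "?d (\<alpha> x) (\<alpha> y) \<le> kobayashi_length G \<alpha> x y"
      by (rule kobayashi_dist_le_length[OF G(1) piecewise_C1_on_final[OF y] im(2)]) (use that in auto)
    also have "\<dots> = F y - F x"
      using kobayashi_length_split[OF G(1) y im(1), of x] that by (simp add: F_def)
    finally show ?thesis .
  qed
  have F0: "F 0 = 0" by (simp add: F_def kobayashi_length_def)
  have F1: "L \<le> F 1" using kobayashi_dist_le_length[OF G(1) a(1,2)] a by (simp add: F_def L_def)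
  have Fmono: "F x \<le> F y" if "0 \<le> x" "x \<le> y" "y \<le> 1" for x y
    using part[OF that] kobayashi_dist_nonneg[of G "\<alpha> x" "\<alpha> y"] by linarith
  have contF: "continuous_on {0..1} F"
    unfolding F_def kobayashi_length_def
    by (rule indefinite_integral_continuous_1[OF piecewise_C1_on_speed_integrable[OF G(1) a(1,2)]])
  \<comment> \<open>At \<open>s = L\<close> the end of the curve is chosen, although its length may exceed \<open>L\<close> by up to \<open>e / 2\<close>.\<close>
  have "\<exists>t\<in>{0..1}. (s = 0 \<longrightarrow> t = 0) \<and> (s = L \<longrightarrow> t = 1) \<and> (s \<noteq> L \<longrightarrow> F t = s)" if "s \<in> {0..L}" for s
  proof -
    consider "s = 0" | "s = L" "s \<noteq> 0" | "s \<noteq> L" "s \<noteq> 0" by blast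
    then show ?thesis
    proof cases
      case 3
      have "\<exists>t\<ge>0. t \<le> 1 \<and> F t = s" by (rule IVT') (use F0 F1 that contF in auto)
      then show ?thesis using 3 by auto
    qed (use F0 \<open>L > 0\<close> in auto)
  qed
  then obtain \<tau> where t: "\<And>s. s \<in> {0..L} \<Longrightarrow> \<tau> s \<in> {0..1} \<and> (s = 0 \<longrightarrow> \<tau> s = 0) \<and> (s = L \<longrightarrow> \<tau> s = 1) \<and> (s \<noteq> L \<longrightarrow> F (\<tau> s) = s)"
    by metis
  have Ft: "s \<le> F (\<tau> s)" "F (\<tau> s) \<le> s + e/2" if "s \<in> {0..L}" for s
    using t[OF that] F1 a(5) e2 by (cases "s = L"; simp add: F_def)+
  have tmono: "\<tau> s \<le> \<tau> s'" if "s \<in> {0..L}" "s' \<in> {0..L}" "s \<le> s'" for s s'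
  proof (rule ccontr)
    assume n: "\<not> \<tau> s \<le> \<tau> s'"
    then have "s \<noteq> s'" "s' \<noteq> L" "s \<noteq> L" using t[OF that(1)] t[OF that(2)] that by auto
    then show False using Fmono[of "\<tau> s'" "\<tau> s"] n t[OF that(1)] t[OF that(2)] that by auto
  qed
  have main: "\<bar>?d (\<alpha> (\<tau> s)) (\<alpha> (\<tau> s')) - (s' - s)\<bar> \<le> e" if s: "s \<in> {0..L}" "s' \<in> {0..L}" "s \<le> s'" for s s'
  proof -
    have ts: "0 \<le> \<tau> s" "\<tau> s \<le> 1" "0 \<le> \<tau> s'" "\<tau> s' \<le> 1" using t[OF s(1)] t[OF s(2)] by auto
    have m: "\<alpha> (\<tau> s) \<in> G" "\<alpha> (\<tau> s') \<in> G" using ts a(2) by (simp_all add: image_subset_iff)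
    have 1: "?d (\<alpha> (\<tau> s)) (\<alpha> (\<tau> s')) \<le> F (\<tau> s') - F (\<tau> s)"
      by (rule part) (use tmono[OF s] ts in auto)
    have 2: "?d p (\<alpha> (\<tau> s)) \<le> F (\<tau> s)" using part[of 0 "\<tau> s"] ts a(3) F0 by simp
    have 3: "?d (\<alpha> (\<tau> s')) q \<le> F 1 - F (\<tau> s')" using part[of "\<tau> s'" 1] ts a(4) by simp
    have 4: "L \<le> ?d p (\<alpha> (\<tau> s)) + ?d (\<alpha> (\<tau> s)) (\<alpha> (\<tau> s')) + ?d (\<alpha> (\<tau> s')) q"
      using kobayashi_dist_triangle[OF G pq(1) m(1) pq(2)] kobayashi_dist_triangle[OF G m pq(2)]
      by (simp add: L_def)
    have 5: "F 1 < L + e/2" using a(5) by (simp add: F_def)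
    show ?thesis using 1 2 3 4 5 Ft[OF s(1)] Ft[OF s(2)] e2 by linarith
  qed
  show ?thesis
  proof (rule that[of "\<lambda>s. \<alpha> (\<tau> s)"])
    fix s s' assume s: "s \<in> {0..L}" "s' \<in> {0..L}"
    have ts: "0 \<le> \<tau> s" "\<tau> s \<le> 1" "0 \<le> \<tau> s'" "\<tau> s' \<le> 1" using t[OF s(1)] t[OF s(2)] by auto
    have m: "\<alpha> (\<tau> s) \<in> G" "\<alpha> (\<tau> s') \<in> G" using ts a(2) by (simp_all add: image_subset_iff)
    show "\<bar>?d (\<alpha> (\<tau> s)) (\<alpha> (\<tau> s')) - \<bar>s - s'\<bar>\<bar> \<le> e"
    proof (cases "s \<le> s'")
      case True
      then show ?thesis using main[OF s] by simp
    next
      case False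
      then show ?thesis using main[OF s(2,1)] kobayashi_dist_commute[OF G m] by simp
    qed
  next
    have 0: "0 \<in> {0..L}" and 1: "L \<in> {0..L}" using \<open>L > 0\<close> by auto
    show "\<alpha> (\<tau> 0) = p" "\<alpha> (\<tau> L) = q" using t[OF 0] t[OF 1] a by auto
    show "\<alpha> (\<tau> s) \<in> G" if "s \<in> {0..L}" for s using t[OF that] a(2) by blast
  qed
qed

lemma kobayashi_geodesic_exists:
  fixes G :: "(complex ^ 'n) set"
  assumes G: "open G" "connected G" and pq: "p \<in> G" "q \<in> G" and pos: "kobayashi_dist G p q > 0"
    and proper: "\<And>r. compact {z \<in> G. kobayashi_dist G p z \<le> r}"
  shows "\<exists>A. geodesic_segment G (kobayashi_dist G) p q A"
proof -
  define L where "L = kobayashi_dist G p q"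
  define K where "K = {z \<in> G. kobayashi_dist G p z \<le> L + 1}"
  show ?thesis
  proof (rule geodesic_of_almost_geodesics[of K _ _ L])
    show "compact K" "K \<subseteq> G" unfolding K_def using proper by auto
    show "continuous_on (K \<times> K) (\<lambda>(x, y). kobayashi_dist G x y)"
      by (rule continuous_on_subset[OF kobayashi_dist_continuous[OF G]]) (auto simp: K_def)
    show "0 \<le> L" using pos by (simp add: L_def)
    fix e :: real assume "e > 0"
    then have "min e 1 > 0" by simp
    then obtain \<gamma> where g: "\<gamma> 0 = p" "\<gamma> L = q" "\<And>t. t \<in> {0..L} \<Longrightarrow> \<gamma> t \<in> G"
        "\<And>s t. s \<in> {0..L} \<Longrightarrow> t \<in> {0..L} \<Longrightarrow> \<bar>kobayashi_dist G (\<gamma> s) (\<gamma> t) - \<bar>s - t\<bar>\<bar> \<le> min e 1"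
      using kobayashi_almost_geodesic[OF G pq _ pos] unfolding L_def by metis
    have K: "\<gamma> t \<in> K" if "t \<in> {0..L}" for t
      using g(3)[OF that] g(4)[of 0 t] that \<open>0 \<le> L\<close> g(1) by (auto simp: K_def)
    let ?\<gamma> = "\<lambda>t. if t \<in> {0..L} then \<gamma> t else p"
    have 1: "?\<gamma> t \<in> K" for t using K[of t] K[of 0] g(1) \<open>0 \<le> L\<close> by auto
    have 2: "?\<gamma> 0 = p" "?\<gamma> L = q" using g \<open>0 \<le> L\<close> by auto
    have 3: "\<bar>kobayashi_dist G (?\<gamma> s) (?\<gamma> t) - \<bar>s - t\<bar>\<bar> \<le> e" if "s \<in> {0..L}" "t \<in> {0..L}" for s t
      using g(4)[OF that] that by simp
    show "\<exists>\<gamma>. (\<forall>t. \<gamma> t \<in> K) \<and> \<gamma> 0 = p \<and> \<gamma> L = q \<and>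
        (\<forall>s\<in>{0..L}. \<forall>t\<in>{0..L}. \<bar>kobayashi_dist G (\<gamma> s) (\<gamma> t) - \<bar>s - t\<bar>\<bar> \<le> e)"
      by (intro exI[of _ ?\<gamma>] conjI allI ballI 1 2 3)
  qed
qed

section \<open>Wide strips in spaces with thin triangles\<close>

text \<open>Geodesics are demanded only between points at positive distance: a geodesic between points at
  distance 0 is constant, so it would force them to coincide, which a pseudodistance does not.\<close>

locale thin_geodesic_space =
  fixes X :: "'a set" and d :: "'a \<Rightarrow> 'a \<Rightarrow> real" and M :: real
  assumes d_refl: "x \<in> X \<Longrightarrow> d x x = 0"
    and d_sym: "x \<in> X \<Longrightarrow> y \<in> X \<Longrightarrow> d x y = d y x"
    and d_triangle: "x \<in> X \<Longrightarrow> y \<in> X \<Longrightarrow> z \<in> X \<Longrightarrow> d x z \<le> d x y + d y z"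
    and geodesics: "x \<in> X \<Longrightarrow> y \<in> X \<Longrightarrow> 0 < d x y \<Longrightarrow> \<exists>A. geodesic_segment X d x y A"
    and M_pos: "M > 0"
    and thin: "geodesic_triangle X d A B C \<Longrightarrow> thin_triangle d M A B C"
begin

lemma segment_reverse: "geodesic_segment X d x y A \<Longrightarrow> geodesic_segment X d y x A"
proof -
  assume "geodesic_segment X d x y A"
  then obtain a b \<alpha> where a: "geodesic X d a b \<alpha>" "\<alpha> a = x" "\<alpha> b = y" "A = \<alpha> ` {a..b}"
    unfolding geodesic_segment_def by blast
  have im: "(\<lambda>t. \<alpha> (- t)) ` {- b..- a} = \<alpha> ` {a..b}"
  proof -
    have "{a..b} = uminus ` {- b..- a}" by simp
    then show ?thesis by (simp only: image_image)
  qed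
  have "geodesic X d (- b) (- a) (\<lambda>t. \<alpha> (- t))"
    using a(1) im unfolding geodesic_def by auto
  then show ?thesis unfolding geodesic_segment_def using a im
    by (intro exI[of _ "- b"] exI[of _ "- a"] exI[of _ "\<lambda>t. \<alpha> (- t)"]) auto
qed

lemma segment_subset: "geodesic_segment X d x y A \<Longrightarrow> w \<in> A \<Longrightarrow> w \<in> X"
  unfolding geodesic_segment_def geodesic_def by blast

lemma segment_dist:
  assumes "geodesic_segment X d x y A" "w \<in> A"
  shows "d x w + d w y = d x y"
  using assms unfolding geodesic_segment_def geodesic_def by auto

lemma segment_dist_points:
  assumes "geodesic_segment X d x y A" "w \<in> A" "w' \<in> A"
  shows "d w w' = \<bar>d x w - d x w'\<bar>"
  using assms unfolding geodesic_segment_def geodesic_def by auto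

lemma d_nonneg: "x \<in> X \<Longrightarrow> y \<in> X \<Longrightarrow> 0 \<le> d x y"
  using d_triangle[of x y x] d_sym[of x y] d_refl[of x] by linarith

text \<open>By connectedness of the side \<open>A\<close> of the triangle \<open>x, y, m\<close>, two points of \<open>A\<close> at distance at most
  1 are \<open>M\<close>-close to points \<open>u\<close> and \<open>v\<close> on the two other sides. Since the detour through \<open>m\<close> costs at most
  \<open>e\<close>, going from \<open>u\<close> to \<open>m\<close> and on to \<open>v\<close> is not much longer than going from \<open>u\<close> to \<open>v\<close>, which is short.\<close>

lemma near_geodesic:
  assumes X: "x \<in> X" "y \<in> X" "m \<in> X" and A: "geodesic_segment X d x y A"
    and pos: "0 < d x m" "0 < d m y" and e: "d x m + d m y \<le> d x y + e"
  obtains w where "w \<in> A" "d m w \<le> 3 * M + 1 + e"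
proof -
  obtain B where B: "geodesic_segment X d y m B" using geodesics[of y m] X pos d_sym[of y m] by auto
  obtain C where C: "geodesic_segment X d m x C" using geodesics[of m x] X pos d_sym[of x m] by auto
  have near: "\<exists>q\<in>B \<union> C. d p q \<le> M" if "p \<in> A" for p
    using thin[of A B C] A B C that unfolding geodesic_triangle_def thin_triangle_def by blast
  obtain a b \<gamma> where g: "geodesic X d a b \<gamma>" "\<gamma> a = x" "\<gamma> b = y" "A = \<gamma> ` {a..b}"
    using A unfolding geodesic_segment_def by blast
  have ab: "a \<le> b" using g by (simp add: geodesic_def)
  have gd: "d (\<gamma> s) (\<gamma> t) = \<bar>s - t\<bar>" if "s \<in> {a..b}" "t \<in> {a..b}" for s t
    using g that by (simp add: geodesic_def)
  \<comment> \<open>Just beyond the supremum of the parameters near \<open>C\<close> the side \<open>A\<close> is near \<open>B\<close>.\<close>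
  define S where "S = {t \<in> {a..b}. \<exists>q\<in>C. d (\<gamma> t) q \<le> M}"
  have xC: "x \<in> C" and yB: "y \<in> B" using B C by (auto simp: geodesic_segment_def geodesic_def)
  have aS: "a \<in> S" using ab g(2) xC d_refl[OF X(1)] M_pos by (force simp: S_def)
  have bdd: "bdd_above S" by (rule bdd_aboveI[of _ b]) (auto simp: S_def)
  obtain t where t: "t \<in> S" "Sup S - 1 < t"
    using less_cSupD[of S "Sup S - 1"] aS by auto
  define t' where "t' = min b (t + 1)"
  have tt: "t \<in> {a..b}" "t' \<in> {a..b}" "\<bar>t - t'\<bar> \<le> 1" using t by (auto simp: S_def t'_def)
  obtain u where u: "u \<in> C" "d (\<gamma> t) u \<le> M" using t by (auto simp: S_def)
  obtain v where v: "v \<in> B" "d (\<gamma> t') v \<le> M"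
  proof (cases "t + 1 \<ge> b")
    case True
    then have "\<gamma> t' = y" using g(3) by (simp add: t'_def)
    then show ?thesis using that[OF yB] d_refl[OF X(2)] M_pos by simp
  next
    case False
    have "t' \<notin> S" using cSup_upper[OF _ bdd, of t'] t(2) False by (auto simp: t'_def)
    moreover have "\<gamma> t' \<in> A" using tt g(4) by blast
    ultimately show ?thesis using near[of "\<gamma> t'"] tt that by (auto simp: S_def)
  qed
  have mem: "u \<in> X" "v \<in> X" "\<gamma> t \<in> X" "\<gamma> t' \<in> X"
    using segment_subset[OF C u(1)] segment_subset[OF B v(1)] segment_subset[OF A] g(4) tt by auto
  have "d u v \<le> d u (\<gamma> t) + d (\<gamma> t) (\<gamma> t') + d (\<gamma> t') v"
    using d_triangle[OF mem(1,3,2)] d_triangle[OF mem(3,4,2)] by linarith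
  then have uv: "d u v \<le> 2 * M + 1"
    using u(2) v(2) gd[OF tt(1,2)] tt(3) d_sym[OF mem(1,3)] by linarith
  have "d x y \<le> d x u + d u v + d v y"
    using d_triangle[OF X(1) mem(1) X(2)] d_triangle[OF mem(1,2) X(2)] by linarith
  moreover have "d m u + d u x = d m x" "d y v + d v m = d y m"
    using segment_dist[OF C u(1)] segment_dist[OF B v(1)] by auto
  moreover have "d u x = d x u" "d m x = d x m" "d y v = d v y" "d y m = d m y" "0 \<le> d v m"
    using d_sym d_nonneg X mem by auto
  ultimately have "d m u \<le> 2 * M + 1 + e" using uv e by linarith
  moreover have "d m (\<gamma> t) \<le> d m u + d u (\<gamma> t)" using d_triangle[OF X(3) mem(1,3)] .
  ultimately have "d m (\<gamma> t) \<le> 3 * M + 1 + e" using u(2) d_sym[OF mem(1,3)] by linarith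
  moreover have "\<gamma> t \<in> A" using tt g(4) by blast
  ultimately show ?thesis using that by blast
qed

text \<open>Cut along the diagonal from \<open>y\<close> to \<open>w\<close>.\<close>

lemma quadrilateral_thin:
  assumes A: "geodesic_segment X d x y A" and B: "geodesic_segment X d y z B"
    and C: "geodesic_segment X d w z C" and D: "geodesic_segment X d x w D"
    and X: "y \<in> X" "w \<in> X" "0 < d y w" "p \<in> A"
  obtains q where "q \<in> B \<union> C \<union> D" "d p q \<le> 2 * M"
proof -
  obtain E where E: "geodesic_segment X d y w E" using geodesics[OF X(1-3)] by blast
  have "geodesic_triangle X d A E D"
    unfolding geodesic_triangle_def using A E segment_reverse[OF D] by blast
  from thin[OF this] obtain q where q: "q \<in> E \<union> D" "d p q \<le> M"
    using \<open>p \<in> A\<close> unfolding thin_triangle_def by blast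
  show ?thesis
  proof (cases "q \<in> D")
    case True
    then show ?thesis using that[of q] q M_pos by simp
  next
    case False
    have "geodesic_triangle X d E C B"
      unfolding geodesic_triangle_def using E C segment_reverse[OF B] by blast
    from thin[OF this] obtain r where r: "r \<in> C \<union> B" "d q r \<le> M"
      using q False unfolding thin_triangle_def by blast
    have "p \<in> X" "q \<in> X" "r \<in> X"
      using segment_subset A B C D E X(4) q(1) r(1) by blast+
    then have "d p r \<le> 2 * M" using d_triangle[of p q r] q r by linarith
    then show ?thesis using that[of r] r by blast
  qed
qed

text \<open>Consider the geodesic quadrilateral with vertices \<open>c T, c (T + 2 N), c' (T + 2 N), c' T\<close>. For
  \<open>N\<close> much larger than \<open>U\<close> the point \<open>c (T + N)\<close> is near the long side over \<open>c\<close> by lemma \<open>near_geodesic\<close>,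
  hence near another side. The two short sides are too far away, so it is near a point \<open>q\<close> of the long side
  over \<open>c'\<close>; and \<open>q\<close> is in turn near the point of \<open>c'\<close> at the corresponding height.\<close>

lemma no_wide_strip:
  assumes mem: "\<And>t. T \<le> t \<Longrightarrow> c t \<in> X \<and> c' t \<in> X"
    and c: "\<And>s t. T \<le> s \<Longrightarrow> s \<le> t \<Longrightarrow> t - s - 1 \<le> d (c s) (c t) \<and> d (c s) (c t) \<le> t - s"
    and c': "\<And>s t. T \<le> s \<Longrightarrow> s \<le> t \<Longrightarrow> t - s - 1 \<le> d (c' s) (c' t) \<and> d (c' s) (c' t) \<le> t - s"
    and U: "\<And>t. T \<le> t \<Longrightarrow> d (c t) (c' t) \<le> U"
    and W: "\<And>s t. T \<le> s \<Longrightarrow> T \<le> t \<Longrightarrow> W \<le> d (c s) (c' t)"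
  shows "W \<le> 11 * M + 7"
proof (rule ccontr)
  assume "\<not> W \<le> 11 * M + 7"
  then have W': "11 * M + 7 < W" by simp
  have "W \<le> U" using U[of T] W[of T T] by simp
  define N where "N = U + 5 * M + 20"
  have N: "N > 20" using \<open>W \<le> U\<close> W' M_pos by (simp add: N_def)
  define x0 x1 x2 x3 m where pts: "x0 = c T" "x1 = c (T + 2 * N)" "x2 = c' T" "x3 = c' (T + 2 * N)" "m = c (T + N)"
  have X: "x0 \<in> X" "x1 \<in> X" "x2 \<in> X" "x3 \<in> X" "m \<in> X" unfolding pts using mem N by auto
  have d0: "N - 1 \<le> d x0 m" "d x0 m \<le> N" "N - 1 \<le> d m x1" "d m x1 \<le> N" "2 * N - 1 \<le> d x0 x1"
      "2 * N - 1 \<le> d x2 x3" "d x2 x3 \<le> 2 * N"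
    using c[of T "T + N"] c[of "T + N" "T + 2 * N"] c[of T "T + 2 * N"] c'[of T "T + 2 * N"] N
    unfolding pts by auto
  have d1: "d x0 x2 \<le> U" "d x1 x3 \<le> U" "W \<le> d x0 x2" "W \<le> d x1 x3" "W \<le> d x1 x2"
    using U[of T] U[of "T + 2 * N"] W N unfolding pts by auto
  have Wpos: "W > 0" using W' M_pos by linarith
  obtain A where A: "geodesic_segment X d x0 x1 A" using geodesics[OF X(1,2)] d0 N by auto
  obtain B where B: "geodesic_segment X d x1 x3 B" using geodesics[OF X(2,4)] d1 Wpos by auto
  obtain C where C: "geodesic_segment X d x2 x3 C" using geodesics[OF X(3,4)] d0 N by auto
  obtain D where D: "geodesic_segment X d x0 x2 D" using geodesics[OF X(1,3)] d1 Wpos by auto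
  obtain w where w: "w \<in> A" "d m w \<le> 3 * M + 1 + 1"
    by (rule near_geodesic[OF X(1,2,5) A, of 1]) (use d0 N in auto)
  obtain q where q: "q \<in> B \<union> C \<union> D" "d w q \<le> 2 * M"
    by (rule quadrilateral_thin[OF A B C D X(2,3) _ w(1)]) (use d1 Wpos in auto)
  have wX: "w \<in> X" using segment_subset[OF A w(1)] .
  have qX: "q \<in> X" using segment_subset[OF B] segment_subset[OF C] segment_subset[OF D] q by blast
  have mq: "d m q \<le> 5 * M + 2" using d_triangle[OF X(5) wX qX] w q by linarith
  have far0: "d q x0 > U + 2"
    using d_triangle[OF X(1) qX X(5)] d_sym[OF qX X(1)] d_sym[OF qX X(5)] mq d0 by (simp add: N_def)
  have far1: "d q x1 > U + 2"
    using d_triangle[OF X(5) qX X(2)] mq d0 by (simp add: N_def)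
  have "q \<notin> D"
  proof
    assume "q \<in> D"
    then show False using segment_dist[OF D, of q] far0 d_nonneg[OF qX X(3)] d1 d_sym[OF qX X(1)]
      by linarith
  qed
  moreover have "q \<notin> B"
  proof
    assume "q \<in> B"
    then show False using segment_dist[OF B, of q] far1 d_nonneg[OF qX X(4)] d1 d_sym[OF qX X(2)]
      by linarith
  qed
  ultimately have qC: "q \<in> C" using q by blast
  define \<tau> where "\<tau> = d x2 q"
  have tau3: "d q x3 = d x2 x3 - \<tau>" using segment_dist[OF C qC] by (simp add: \<tau>_def)
  have tau1: "\<tau> > 2"
    using d_triangle[OF X(1,3) qX] d_sym[OF qX X(1)] far0 d1 by (simp add: \<tau>_def)
  have tau2: "\<tau> < 2 * N - 2"
    using d_triangle[OF qX X(4,2)] d_sym[OF X(2,4)] far1 d1 tau3 d0 by linarith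
  define v where "v = c' (T + \<tau>)"
  have vX: "v \<in> X" unfolding v_def using mem tau1 by simp
  have dv: "\<tau> - 1 \<le> d x2 v" "d x2 v \<le> \<tau>" "2 * N - \<tau> - 1 \<le> d v x3" "d v x3 \<le> 2 * N - \<tau>"
    using c'[of T "T + \<tau>"] c'[of "T + \<tau>" "T + 2 * N"] tau1 tau2 unfolding v_def pts by auto
  obtain w' where w': "w' \<in> C" "d v w' \<le> 3 * M + 1 + 1"
    by (rule near_geodesic[OF X(3,4) vX C, of 1]) (use dv tau1 tau2 d0 in auto)
  have w'X: "w' \<in> X" using segment_subset[OF C w'(1)] .
  have "\<bar>d x2 w' - d x2 v\<bar> \<le> d v w'"
    using d_triangle[OF X(3) vX w'X] d_triangle[OF X(3) w'X vX] d_sym[OF vX w'X] by linarith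
  then have "d q w' \<le> 3 * M + 3"
    using segment_dist_points[OF C qC w'(1)] w'(2) dv by (simp add: \<tau>_def)
  then have "d m v \<le> 11 * M + 7"
    using d_triangle[OF X(5) qX vX] d_triangle[OF qX w'X vX] d_sym[OF vX w'X] mq w'(2) by linarith
  moreover have "W \<le> d m v" unfolding pts v_def using W N tau1 by simp
  ultimately show False using W' by linarith
qed

end

theorem not_gromov_hyperbolic_if_wide_strips:
  fixes X :: "'a set" and d :: "'a \<Rightarrow> 'a \<Rightarrow> real"
  assumes d: "\<And>x. x \<in> X \<Longrightarrow> d x x = 0" "\<And>x y. x \<in> X \<Longrightarrow> y \<in> X \<Longrightarrow> d x y = d y x"
      "\<And>x y z. x \<in> X \<Longrightarrow> y \<in> X \<Longrightarrow> z \<in> X \<Longrightarrow> d x z \<le> d x y + d y z"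
    and geodesics: "\<And>x y. x \<in> X \<Longrightarrow> y \<in> X \<Longrightarrow> 0 < d x y \<Longrightarrow> \<exists>A. geodesic_segment X d x y A"
    and strips: "\<And>W. \<exists>c c' T U. \<forall>t\<ge>T. c t \<in> X \<and> c' t \<in> X \<and> d (c t) (c' t) \<le> U \<and>
      (\<forall>s\<ge>T. W \<le> d (c s) (c' t) \<and> (s \<le> t \<longrightarrow>
          t - s - 1 \<le> d (c s) (c t) \<and> d (c s) (c t) \<le> t - s \<and>
          t - s - 1 \<le> d (c' s) (c' t) \<and> d (c' s) (c' t) \<le> t - s))"
  shows "\<not> gromov_hyperbolic X d"
proof
  assume "gromov_hyperbolic X d"
  then obtain M where M: "M > 0" "\<And>A B C. geodesic_triangle X d A B C \<Longrightarrow> thin_triangle d M A B C"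
    unfolding gromov_hyperbolic_def by blast
  interpret thin_geodesic_space X d M
    by unfold_locales (use d geodesics M in auto)
  obtain c c' T U where s: "\<forall>t\<ge>T. c t \<in> X \<and> c' t \<in> X \<and> d (c t) (c' t) \<le> U \<and>
      (\<forall>s\<ge>T. 11 * M + 8 \<le> d (c s) (c' t) \<and> (s \<le> t \<longrightarrow>
          t - s - 1 \<le> d (c s) (c t) \<and> d (c s) (c t) \<le> t - s \<and>
          t - s - 1 \<le> d (c' s) (c' t) \<and> d (c' s) (c' t) \<le> t - s))"
    using strips[of "11 * M + 8"] by metis
  have "11 * M + 8 \<le> 11 * M + 7"
    by (rule no_wide_strip[of T c c' U]) (use s in auto)
  then show False by simp
qed

section \<open>Convex domains without finitely many hyperplanes\<close>

lemma complex_hyperplane_cdot: "complex_hyperplane H \<longleftrightarrow> (\<exists>a b. a \<noteq> 0 \<and> H = {z. cdot a z = b})"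
  by (simp add: complex_hyperplane_def cdot_def)

lemma closed_complex_hyperplane: "complex_hyperplane H \<Longrightarrow> closed H"
  by (auto simp: complex_hyperplane_cdot intro!: closed_Collect_eq continuous_intros)

lemma closed_hyperplanes: "finite F \<Longrightarrow> (\<And>H. H \<in> F \<Longrightarrow> complex_hyperplane H) \<Longrightarrow> closed (\<Union>F)"
  by (intro closed_Union) (auto intro: closed_complex_hyperplane)

text \<open>An affine function on the line that is nonzero at \<open>\<zeta> = 0\<close> has at most one zero.\<close>

lemma finite_line_meets_hyperplanes:
  assumes "finite F" "\<And>H. H \<in> F \<Longrightarrow> complex_hyperplane H" "p \<notin> \<Union>F"
  shows "finite {\<zeta>. p + \<zeta> *s w \<in> \<Union>F}"
proof -
  have "finite {\<zeta>. p + \<zeta> *s w \<in> H}" if HF: "H \<in> F" for H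
  proof -
    obtain a b where H: "H = {z. cdot a z = b}" using assms(2)[OF HF] by (auto simp: complex_hyperplane_cdot)
    have "cdot a p \<noteq> b" using HF assms(3) H by blast
    then have "{\<zeta>. p + \<zeta> *s w \<in> H} \<subseteq> {(b - cdot a p) / cdot a w}"
      by (auto simp: H cdot_add cdot_cscale field_simps)
    then show ?thesis by (rule finite_subset) simp
  qed
  moreover have "{\<zeta>. p + \<zeta> *s w \<in> \<Union>F} = (\<Union>H\<in>F. {\<zeta>. p + \<zeta> *s w \<in> H})" by auto
  ultimately show ?thesis using assms(1) by simp
qed

text \<open>Two points lie on a complex line, whose part in \<open>\<Omega>\<close> is a convex open subset of the plane;
  removing finitely many points leaves it connected.\<close>

lemma connected_convex_minus_hyperplanes:
  fixes \<Omega> :: "(complex ^ 'n) set"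
  assumes \<Omega>: "open \<Omega>" "convex \<Omega>" and F: "finite F" "\<And>H. H \<in> F \<Longrightarrow> complex_hyperplane H"
  shows "connected (\<Omega> - \<Union>F)"
proof (subst connected_iff_connected_component, intro ballI)
  fix p q assume p: "p \<in> \<Omega> - \<Union>F" and q: "q \<in> \<Omega> - \<Union>F"
  define line where "line = (\<lambda>\<zeta>. p + \<zeta> *s (q - p))"
  have "line = (\<lambda>\<zeta>. \<chi> i. p $ i + \<zeta> * (q $ i - p $ i))"
    by (simp add: line_def fun_eq_iff vec_eq_iff algebra_simps)
  moreover have "continuous_on S (\<lambda>\<zeta>. \<chi> i. p $ i + \<zeta> * (q $ i - p $ i))" for S
    by (intro continuous_on_vec_lambda continuous_on_add continuous_on_mult continuous_on_const continuous_on_id)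
  ultimately have cont: "continuous_on S line" for S by simp
  define V where "V = line -` \<Omega>"
  have "open V" unfolding V_def using continuous_open_preimage[OF cont open_UNIV \<Omega>(1)] by simp
  have lin: "line (u *\<^sub>R x + v *\<^sub>R y) = u *\<^sub>R line x + v *\<^sub>R line y" if "u + v = 1" for u v x y
  proof -
    have "p = u *\<^sub>R p + v *\<^sub>R p" using that by (metis scaleR_add_left scaleR_one)
    moreover have "(u *\<^sub>R x + v *\<^sub>R y) *s (q - p) = u *\<^sub>R (x *s (q - p)) + v *\<^sub>R (y *s (q - p))"
      by (simp add: vec_eq_iff algebra_simps)
    ultimately show ?thesis unfolding line_def scaleR_add_right by (simp add: algebra_simps)
  qed
  have "convex V"
    using \<Omega>(2) unfolding convex_def V_def by (simp add: lin)
  define Z where "Z = {\<zeta>. p + \<zeta> *s (q - p) \<in> \<Union>F}"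
  have "finite Z" unfolding Z_def by (rule finite_line_meets_hyperplanes[OF F]) (use p in auto)
  have "connected (V - Z)"
    by (rule connected_open_diff_countable)
       (use \<open>open V\<close> convex_connected[OF \<open>convex V\<close>] \<open>finite Z\<close> in \<open>auto simp: countable_finite\<close>)
  then have "connected (line ` (V - Z))" by (rule connected_continuous_image[OF cont])
  moreover have "line ` (V - Z) \<subseteq> \<Omega> - \<Union>F" by (auto simp: V_def Z_def line_def)
  moreover have "p \<in> line ` (V - Z)"
    by (rule image_eqI[of _ _ 0]) (use p in \<open>auto simp: V_def Z_def line_def\<close>)
  moreover have "q \<in> line ` (V - Z)"
    by (rule image_eqI[of _ _ 1]) (use q in \<open>auto simp: V_def Z_def line_def\<close>)
  ultimately show "connected_component (\<Omega> - \<Union>F) p q"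
    unfolding connected_component_def by blast
qed

text \<open>If a point of \<open>H\<close> lies on \<open>H' \<noteq> H\<close>, then the linear parts of the two equations are not
  proportional, so some direction along \<open>H\<close> leaves \<open>H'\<close>; a small step in it does not reach the hyperplanes
  that were avoided before.\<close>

lemma hyperplane_point_off_hyperplanes:
  assumes H: "complex_hyperplane H" and B: "open B" "H \<inter> B \<noteq> {}"
  shows "finite F \<Longrightarrow> (\<And>H'. H' \<in> F \<Longrightarrow> complex_hyperplane H' \<and> H' \<noteq> H) \<Longrightarrow> \<exists>p\<in>H \<inter> B. p \<notin> \<Union>F"
proof (induction F rule: finite_induct)
  case empty
  then show ?case using B by auto
next
  case (insert H' F)
  obtain p where p: "p \<in> H" "p \<in> B" "p \<notin> \<Union>F" using insert by auto
  show ?case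
  proof (cases "p \<in> H'")
    case False
    then show ?thesis using p by auto
  next
    case True
    obtain a b where a: "a \<noteq> 0" "H = {z. cdot a z = b}" using H by (auto simp: complex_hyperplane_cdot)
    obtain a' b' where a': "a' \<noteq> 0" "H' = {z. cdot a' z = b'}" using insert.prems[of H'] by (auto simp: complex_hyperplane_cdot)
    have "\<exists>w. cdot a w = 0 \<and> cdot a' w \<noteq> 0"
    proof (rule ccontr)
      assume w: "\<nexists>w. cdot a w = 0 \<and> cdot a' w \<noteq> 0"
      then have ker: "cdot a' w = 0" if "cdot a w = 0" for w using that w by blast
      obtain v where v: "cdot a v = 1" using cdot_surj[OF a(1)] .
      have c: "cdot a' z = cdot a z * cdot a' v" for z
        using ker[of "z - cdot a z *s v"] v by (simp add: cdot_diff cdot_cscale)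
      obtain v' where "cdot a' v' = 1" using cdot_surj[OF a'(1)] .
      then have nz: "cdot a' v \<noteq> 0" using c[of v'] by auto
      have "cdot a p = b" "cdot a' p = b'" using p(1) True a a' by auto
      then have "cdot a' z = b' \<longleftrightarrow> cdot a z = b" for z using c[of z] c[of p] nz by auto
      then have "H' = H" by (simp add: a(2) a'(2))
      then show False using insert.prems[of H'] by blast
    qed
    then obtain w where w: "cdot a w = 0" "cdot a' w \<noteq> 0" by blast
    have "open (B - \<Union>F)" using B closed_hyperplanes[of F] insert by (intro open_Diff) auto
    then obtain e where e: "e > 0" "ball p e \<subseteq> B - \<Union>F" using p openE by blast
    define s where "s = e / (2 * norm w)"
    have "w \<noteq> 0" using w(2) by (auto simp: cdot_def)
    then have s: "s > 0" "s * norm w < e" using e(1) by (auto simp: s_def)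
    have "p + s *\<^sub>R w \<in> ball p e" using s by (simp add: dist_norm)
    moreover have "p + s *\<^sub>R w \<in> H" using p(1) w a(2) by (simp add: cdot_add cdot_scaleR)
    moreover have "p + s *\<^sub>R w \<notin> H'" using True w s a'(2) by (simp add: cdot_add cdot_scaleR)
    ultimately show ?thesis using e(2) by blast
  qed
qed

lemma pos_pluriharmonic_bounds:
  fixes G :: "(complex ^ 'n) set"
  assumes G: "open G" "connected G" and h: "pos_pluriharmonic G h" and "p \<in> G" "z \<in> G"
    and r: "kobayashi_dist G p z \<le> r"
  shows "h p * exp (- 2 * r) \<le> h z" "h z \<le> h p * exp (2 * r)"
proof -
  have pos: "h p > 0" "h z > 0" using h assms by (auto simp: pos_pluriharmonic_def)
  have "\<bar>ln (h p) - ln (h z)\<bar> \<le> 2 * r"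
    using ln_pos_pluriharmonic_le_dist[OF G h assms(4,5)] r by linarith
  then have "ln (h p) + (- 2 * r) \<le> ln (h z)" "ln (h z) \<le> ln (h p) + 2 * r" by linarith+
  then have "exp (ln (h p) + (- 2 * r)) \<le> exp (ln (h z))" "exp (ln (h z)) \<le> exp (ln (h p) + 2 * r)"
    by (simp_all only: exp_le_cancel_iff)
  then show "h p * exp (- 2 * r) \<le> h z" "h z \<le> h p * exp (2 * r)"
    using pos by (simp_all only: exp_add exp_ln)
qed

lemma supporting_pluriharmonic:
  fixes \<Omega> :: "(complex ^ 'n) set"
  assumes \<Omega>: "open \<Omega>" "convex \<Omega>" and \<xi>: "\<xi> \<in> closure \<Omega>" "\<xi> \<notin> \<Omega>" and G: "G \<subseteq> \<Omega>"
  obtains a where "\<And>z. z \<in> \<Omega> \<Longrightarrow> 0 < a \<bullet> (z - \<xi>)" "pos_pluriharmonic G (\<lambda>z. a \<bullet> (z - \<xi>))"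
proof -
  have ri: "rel_interior \<Omega> = \<Omega>" using \<Omega>(1) by (rule rel_interior_open)
  obtain a where "a \<noteq> 0" and a: "\<And>y. y \<in> \<Omega> \<Longrightarrow> a \<bullet> \<xi> < a \<bullet> y"
    using supporting_hyperplane_relative_frontier[OF \<Omega>(2) \<xi>(1)] \<xi>(2) unfolding ri by metis
  define a' where "a' = (\<chi> i. cnj (a $ i))"
  have eq: "Re (cdot a' z - cdot a' \<xi>) = a \<bullet> (z - \<xi>)" for z
    using Re_cdot_cnj[of a] unfolding a'_def by (simp add: inner_diff_right)
  have pos: "0 < a \<bullet> (z - \<xi>)" if "z \<in> \<Omega>" for z using a[OF that] by (simp add: inner_diff_right)
  have "pos_pluriharmonic G (\<lambda>z. Re (cdot a' z - cdot a' \<xi>))"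
    by (rule pos_pluriharmonic_Re_affine) (use pos G in \<open>auto simp only: eq\<close>)
  then show ?thesis using that[OF pos] unfolding eq by blast
qed

lemma hyperplane_pluriharmonic:
  fixes G :: "(complex ^ 'n) set"
  assumes "bounded G" and H: "H = {z. cdot a z = b}" "H \<inter> G = {}"
  obtains R where "R > 0" "pos_pluriharmonic G (\<lambda>z. ln (R / cmod (cdot a z - b)))"
proof -
  obtain B where B: "\<And>z. z \<in> G \<Longrightarrow> norm z \<le> B" using assms(1) bounded_iff by blast
  define K where "K = (\<Sum>i\<in>UNIV. cmod (a $ i))"
  have K: "K \<ge> 0" by (simp add: K_def sum_nonneg)
  define R where "R = K * \<bar>B\<bar> + cmod b + 1"
  have R: "R > 0" using K by (simp add: R_def add_nonneg_pos)
  have "cmod (cdot a z - b) < R" if "z \<in> G" for z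
  proof -
    have "cmod (cdot a z) \<le> K * norm z" using norm_cdot_le[of a z] by (simp add: K_def)
    also have "\<dots> \<le> K * \<bar>B\<bar>" using B[OF that] K by (intro mult_left_mono) auto
    finally show ?thesis using norm_triangle_ineq4[of "cdot a z" b] by (simp add: R_def)
  qed
  moreover have "cdot a z - b \<noteq> 0" if "z \<in> G" for z using that H by auto
  ultimately have "pos_pluriharmonic G (\<lambda>z. ln (R / cmod (cdot a z - b)))"
    by (intro pos_pluriharmonic_log_affine)
  then show ?thesis using that R by blast
qed

text \<open>On a ball about \<open>p\<close> every positive pluriharmonic function is bounded and bounded away from 0. Hence
  a limit point of the ball is not on the boundary of \<open>\<Omega>\<close>, where a supporting function vanishes, and not on a
  hyperplane \<open>{\<ell> = 0}\<close>, where \<open>ln (R / \<bar>\<ell>\<bar>)\<close> is infinite.\<close>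

lemma kobayashi_balls_compact:
  fixes \<Omega> :: "(complex ^ 'n) set"
  assumes \<Omega>: "open \<Omega>" "convex \<Omega>" "bounded \<Omega>" and F: "finite F" "\<And>H. H \<in> F \<Longrightarrow> complex_hyperplane H"
  defines "G \<equiv> \<Omega> - \<Union>F"
  assumes p: "p \<in> G"
  shows "compact {z \<in> G. kobayashi_dist G p z \<le> r}"
proof -
  have G: "open G" "connected G" unfolding G_def
    using \<Omega> closed_hyperplanes[OF F] connected_convex_minus_hyperplanes[OF \<Omega>(1,2) F] by auto
  have bG: "bounded G" using \<Omega>(3) by (auto simp: G_def intro: bounded_subset)
  let ?B = "{z \<in> G. kobayashi_dist G p z \<le> r}"
  have "closed ?B"
    unfolding closed_sequential_limits
  proof (intro allI impI, elim conjE)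
    fix x l assume x: "\<forall>n. x n \<in> ?B" and lim: "x \<longlonglongrightarrow> l"
    have xG: "x n \<in> G" and xr: "kobayashi_dist G p (x n) \<le> r" for n using x by auto
    have "l \<in> closure \<Omega>" using lim xG closure_sequential[of l \<Omega>] by (auto simp: G_def)
    have "l \<in> \<Omega>"
    proof (rule ccontr)
      assume "l \<notin> \<Omega>"
      then obtain a where a: "\<And>z. z \<in> \<Omega> \<Longrightarrow> 0 < a \<bullet> (z - l)" "pos_pluriharmonic G (\<lambda>z. a \<bullet> (z - l))"
        using supporting_pluriharmonic[OF \<Omega>(1,2) \<open>l \<in> closure \<Omega>\<close>, of G] by (auto simp: G_def)
      have "(\<lambda>n. a \<bullet> (x n - l)) \<longlonglongrightarrow> a \<bullet> (l - l)" by (intro tendsto_intros lim)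
      moreover have "a \<bullet> (p - l) * exp (- 2 * r) \<le> a \<bullet> (x n - l)" for n
        by (rule pos_pluriharmonic_bounds(1)[OF G a(2) p xG xr])
      ultimately have "a \<bullet> (p - l) * exp (- 2 * r) \<le> a \<bullet> (l - l)" by (meson LIMSEQ_le_const)
      then show False using a(1)[of p] p by (simp add: G_def mult_le_0_iff)
    qed
    moreover have "l \<notin> H" if HF: "H \<in> F" for H
    proof
      assume "l \<in> H"
      obtain a b where H: "H = {z. cdot a z = b}" using F(2)[OF HF] by (auto simp: complex_hyperplane_cdot)
      obtain R where R: "R > 0" "pos_pluriharmonic G (\<lambda>z. ln (R / cmod (cdot a z - b)))"
        by (rule hyperplane_pluriharmonic[OF bG H]) (use HF in \<open>auto simp: G_def\<close>)
      define C where "C = ln (R / cmod (cdot a p - b)) * exp (2 * r)"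
      have "R * exp (- C) \<le> cmod (cdot a (x n) - b)" for n
      proof -
        have nz: "cdot a (x n) - b \<noteq> 0" using xG[of n] HF H by (auto simp: G_def)
        have "ln (R / cmod (cdot a (x n) - b)) \<le> C"
          unfolding C_def by (rule pos_pluriharmonic_bounds(2)[OF G R(2) p xG xr])
        then have "R / cmod (cdot a (x n) - b) \<le> exp C"
          using R(1) nz by (metis divide_pos_pos exp_le_cancel_iff exp_ln zero_less_norm_iff)
        then show ?thesis using nz by (simp add: exp_minus field_simps)
      qed
      moreover have "(\<lambda>n. cmod (cdot a (x n) - b)) \<longlonglongrightarrow> cmod (cdot a l - b)"
      proof -
        have "(\<lambda>n. cdot a (x n)) \<longlonglongrightarrow> cdot a l"
          by (rule continuous_on_tendsto_compose[OF continuous_on_cdot[of UNIV a] lim]) auto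
        then show ?thesis by (intro tendsto_intros)
      qed
      ultimately have "R * exp (- C) \<le> cmod (cdot a l - b)" by (meson LIMSEQ_le_const)
      moreover have "cmod (cdot a l - b) = 0" using \<open>l \<in> H\<close> H by simp
      ultimately show False using R(1) by (simp add: mult_le_0_iff)
    qed
    ultimately have lG: "l \<in> G" by (auto simp: G_def)
    have "continuous_on G (\<lambda>z. (p, z))" by (intro continuous_intros)
    then have "continuous_on G (\<lambda>z. case (p, z) of (x, y) \<Rightarrow> kobayashi_dist G x y)"
      by (rule continuous_on_compose2[OF kobayashi_dist_continuous[OF G]]) (use p in auto)
    then have "continuous_on G (kobayashi_dist G p)" by simp
    then have "(\<lambda>n. kobayashi_dist G p (x n)) \<longlonglongrightarrow> kobayashi_dist G p l"
      by (rule continuous_on_tendsto_compose[OF _ lim lG]) (use xG in auto)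
    then have "kobayashi_dist G p l \<le> r" using xr by (meson LIMSEQ_le_const2)
    then show "l \<in> ?B" using lG by simp
  qed
  moreover have "bounded ?B" using bG by (rule bounded_subset) auto
  ultimately show ?thesis by (simp add: compact_eq_bounded_closed)
qed

section \<open>Rays into the cusp\<close>

text \<open>The distance to the hyperplane is doubly exponential in \<open>t\<close>, because \<open>ln (- ln r) / 2\<close> is arc
  length along a radius of the punctured unit disc.\<close>

definition cusp_ray :: "complex ^ 'n \<Rightarrow> complex ^ 'n \<Rightarrow> real \<Rightarrow> complex ^ 'n" where
  "cusp_ray v x t = x + of_real (exp (- exp (2 * t))) *s v"

text \<open>The extremal disc is the universal covering
  \<open>\<zeta> \<mapsto> exp (- E (1 + \<zeta>) / (1 - \<zeta>))\<close> of the punctured disc with \<open>E = exp (2 * t)\<close>; its derivative at 0 is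
  precisely the velocity of the ray.\<close>

lemma cusp_ray_speed_le:
  fixes v x :: "complex ^ 'n"
  assumes "\<And>\<zeta>. \<zeta> \<noteq> 0 \<Longrightarrow> cmod \<zeta> < 1 \<Longrightarrow> x + \<zeta> *s v \<in> G"
  shows "kobayashi_metric G (cusp_ray v x t) (of_real (- 2 * exp (2 * t) * exp (- exp (2 * t))) *s v) \<le> 1"
proof -
  define E where "E = exp (2 * t)"
  have E: "E > 0" by (simp add: E_def)
  define g where "g = (\<lambda>\<zeta> :: complex. exp (- (of_real E * ((1 + \<zeta>) / (1 - \<zeta>)))))"
  define f where "f = (\<lambda>\<zeta>. x + g \<zeta> *s v)"
  have der: "(g has_field_derivative of_real (- 2 * E * exp (- E))) (at 0)"
    unfolding g_def by (auto intro!: derivative_eq_intros simp: exp_of_real[symmetric])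
  have hol: "g holomorphic_on ball 0 1"
    unfolding g_def by (intro holomorphic_intros) auto
  have lt1: "cmod (g \<zeta>) < 1" if "cmod \<zeta> < 1" for \<zeta>
  proof -
    have "Re ((1 + \<zeta>) / (1 - \<zeta>)) = (1 - (cmod \<zeta>)\<^sup>2) / (cmod (1 - \<zeta>))\<^sup>2"
      unfolding cmod_power2 by (simp add: Re_divide power2_eq_square algebra_simps)
    also have "\<dots> > 0" using that by (intro divide_pos_pos) (auto simp: power_less_one_iff abs_square_less_1)
    finally have "0 < E * Re ((1 + \<zeta>) / (1 - \<zeta>))" using E by simp
    then have "Re (- (of_real E * ((1 + \<zeta>) / (1 - \<zeta>)))) < 0"
      by (simp only: uminus_complex.sel times_complex.sel Re_complex_of_real Im_complex_of_real
          mult_zero_left diff_0_right neg_less_0_iff_less)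
    then show ?thesis unfolding g_def norm_exp_eq_Re by (simp only: exp_less_one_iff)
  qed
  have "holomorphic_disc G f"
    unfolding holomorphic_disc_def
  proof (intro conjI allI)
    show "(\<lambda>\<zeta>. f \<zeta> $ i) holomorphic_on ball 0 1" for i
      unfolding f_def by (simp, intro holomorphic_intros hol)
    show "f ` ball 0 1 \<subseteq> G" using lt1 assms by (auto simp: f_def g_def)
  qed
  moreover have "f 0 = cusp_ray v x t"
    by (simp add: f_def g_def cusp_ray_def E_def exp_of_real[symmetric])
  moreover have "1 *s disc_tangent f = of_real (- 2 * exp (2 * t) * exp (- exp (2 * t))) *s v"
  proof -
    have "((\<lambda>\<zeta>. x $ i + g \<zeta> * v $ i) has_field_derivative of_real (- 2 * E * exp (- E)) * v $ i) (at 0)" for i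
      using der by (auto intro!: derivative_eq_intros)
    then have "deriv (\<lambda>\<zeta>. f \<zeta> $ i) 0 = of_real (- 2 * E * exp (- E)) * v $ i" for i
      by (simp add: f_def DERIV_imp_deriv)
    then show ?thesis by (simp add: vec_eq_iff E_def)
  qed
  ultimately show ?thesis using kobayashi_metric_le[of G f _ 1] by simp
qed

lemma cusp_ray_dist_le:
  fixes v x :: "complex ^ 'n"
  assumes G: "open G" and vx: "\<And>\<zeta>. \<zeta> \<noteq> 0 \<Longrightarrow> cmod \<zeta> < 1 \<Longrightarrow> x + \<zeta> *s v \<in> G" and "s \<le> t"
  shows "kobayashi_dist G (cusp_ray v x s) (cusp_ray v x t) \<le> t - s"
proof -
  have "kobayashi_dist G (cusp_ray v x s) (cusp_ray v x t) \<le> 1 * (t - s)"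
  proof (rule kobayashi_dist_le_smooth[OF G \<open>s \<le> t\<close>])
    show "cusp_ray v x ` {s..t} \<subseteq> G" using vx by (auto simp: cusp_ray_def)
    show "kobayashi_metric G (cusp_ray v x u) ((- 2 * exp (2 * u) * exp (- exp (2 * u))) *\<^sub>R v) \<le> 1" for u
      using cusp_ray_speed_le[of x v G u] vx unfolding scaleR_eq_cscale by blast
    show "(cusp_ray v x has_vector_derivative (- 2 * exp (2 * u) * exp (- exp (2 * u))) *\<^sub>R v) (at u)" for u
    proof -
      have "((\<lambda>u. exp (- exp (2 * u))) has_real_derivative - 2 * exp (2 * u) * exp (- exp (2 * u))) (at u)"
        by (auto intro!: derivative_eq_intros)
      then have "((\<lambda>u. exp (- exp (2 * u)) *\<^sub>R v) has_vector_derivative (- 2 * exp (2 * u) * exp (- exp (2 * u))) *\<^sub>R v) (at u)"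
        by (rule has_vector_derivative_scaleR[THEN has_vector_derivative_eq_rhs]) (auto intro: derivative_intros)
      then show ?thesis unfolding cusp_ray_def[abs_def] scaleR_eq_cscale[symmetric]
        by (auto intro!: derivative_eq_intros)
    qed
    show "continuous_on {s..t} (\<lambda>u. (- 2 * exp (2 * u) * exp (- exp (2 * u))) *\<^sub>R v)"
      by (intro continuous_intros)
  qed
  then show ?thesis by simp
qed

text \<open>The shift \<open>k\<close> accounts for the difference between the radius \<open>R\<close> of a punctured disc
  that contains the values of \<open>cdot a z - b\<close> and the radius of the embedded one.\<close>

lemma ln_shifted_exp_diff_ge:
  assumes "2 * \<bar>k\<bar> \<le> exp (2 * s)" "s \<le> (t::real)"
  shows "2 * (t - s) - 2 \<le> ln (k + exp (2 * t)) - ln (k + exp (2 * s))"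
proof -
  have st: "exp (2 * s) \<le> exp (2 * t)" using assms by simp
  have pos: "k + exp (2 * s) > 0" using assms(1) exp_gt_zero[of "2 * s"] by linarith
  have "exp (2 * t) / 2 \<le> k + exp (2 * t)" using assms(1) st by linarith
  then have "ln (exp (2 * t) / 2) \<le> ln (k + exp (2 * t))" by (intro ln_mono) auto
  then have 1: "2 * t - ln 2 \<le> ln (k + exp (2 * t))" by (simp add: ln_div)
  have "ln (k + exp (2 * s)) \<le> ln (2 * exp (2 * s))"
    using assms(1) pos by (intro ln_mono) auto
  then have 2: "ln (k + exp (2 * s)) \<le> 2 * s + ln 2" by (simp add: ln_mult)
  have "ln 2 \<le> (1::real)" using ln_le_minus_one[of 2] by simp
  then show ?thesis using 1 2 unfolding right_diff_distrib by linarith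
qed

lemma cusp_ray_dist_ge:
  fixes v x :: "complex ^ 'n"
  assumes G: "open G" "connected G" and vx: "\<And>\<zeta>. \<zeta> \<noteq> 0 \<Longrightarrow> cmod \<zeta> < 1 \<Longrightarrow> x + \<zeta> *s v \<in> G"
    and R: "R > 0" "pos_pluriharmonic G (\<lambda>z. ln (R / cmod (cdot a z - b)))"
    and ab: "cdot a x = b" "cdot a v \<noteq> 0"
    and st: "2 * \<bar>ln (R / cmod (cdot a v))\<bar> \<le> exp (2 * s)" "s \<le> t"
  shows "t - s - 1 \<le> kobayashi_dist G (cusp_ray v x s) (cusp_ray v x t)"
proof -
  let ?k = "ln (R / cmod (cdot a v))"
  have mem: "cusp_ray v x u \<in> G" for u using vx by (simp add: cusp_ray_def)
  have h: "ln (R / cmod (cdot a (cusp_ray v x u) - b)) = ?k + exp (2 * u)" for u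
    using R(1) ab by (simp add: cusp_ray_def cdot_add cdot_cscale norm_mult ln_div ln_mult)
  have "\<bar>ln (?k + exp (2 * s)) - ln (?k + exp (2 * t))\<bar> \<le> 2 * kobayashi_dist G (cusp_ray v x s) (cusp_ray v x t)"
    using ln_pos_pluriharmonic_le_dist[OF G R(2) mem[of s] mem[of t]] unfolding h .
  moreover have "t - s - 1 \<le> D" if "\<bar>x - y\<bar> \<le> 2 * D" "2 * (t - s) - 2 \<le> y - x" for x y D :: real
    using that unfolding right_diff_distrib by linarith
  ultimately show ?thesis using ln_shifted_exp_diff_ge[OF st] by blast
qed

text \<open>Follow a line in \<open>H\<close> from a point \<open>p\<close> off the other hyperplanes to a boundary point \<open>\<xi>\<close> of \<open>\<Omega>\<close>.
  From some parameter \<open>e1\<close> on it avoids the other hyperplanes. The rays start at the points with parameters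
  \<open>e1\<close> and \<open>e2\<close>, where \<open>e2\<close> is so close to the end that the supporting function at \<open>\<xi>\<close> has decreased by a
  factor \<open>exp (- 2 \<bar>W\<bar>) / 4\<close>. The 4 compensates for the transverse displacement, which changes the values by a
  factor of at most 2 once the rays are deep in the cusp.\<close>

lemma wide_strips_in_convex_minus_hyperplanes:
  fixes \<Omega> :: "(complex ^ 'n) set" and \<S> :: "(complex ^ 'n) set set"
  assumes dim: "CARD('n) \<ge> 2" and \<Omega>: "open \<Omega>" "convex \<Omega>" "bounded \<Omega>"
    and S: "finite \<S>" "\<And>H. H \<in> \<S> \<Longrightarrow> complex_hyperplane H" and H: "H \<in> \<S>" "H \<inter> \<Omega> \<noteq> {}"
  defines "G \<equiv> \<Omega> - \<Union>\<S>"
  shows "\<exists>c c' T U. \<forall>t\<ge>T. c t \<in> G \<and> c' t \<in> G \<and> kobayashi_dist G (c t) (c' t) \<le> U \<and>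
      (\<forall>s\<ge>T. W \<le> kobayashi_dist G (c s) (c' t) \<and> (s \<le> t \<longrightarrow>
          t - s - 1 \<le> kobayashi_dist G (c s) (c t) \<and> kobayashi_dist G (c s) (c t) \<le> t - s \<and>
          t - s - 1 \<le> kobayashi_dist G (c' s) (c' t) \<and> kobayashi_dist G (c' s) (c' t) \<le> t - s))"
proof -
  have G: "open G" "connected G" unfolding G_def
    using \<Omega> closed_hyperplanes[OF S] connected_convex_minus_hyperplanes[OF \<Omega>(1,2) S] by auto
  have bG: "bounded G" using \<Omega>(3) by (auto simp: G_def intro: bounded_subset)
  obtain a b where a: "a \<noteq> 0" and Hab: "H = {z. cdot a z = b}"
    using S(2)[OF H(1)] by (auto simp: complex_hyperplane_cdot)
  define F where "F = \<S> - {H}"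
  have F: "finite F" "\<And>H'. H' \<in> F \<Longrightarrow> complex_hyperplane H'" "\<And>H'. H' \<in> F \<Longrightarrow> complex_hyperplane H' \<and> H' \<noteq> H"
    using S by (auto simp: F_def)
  define Y where "Y = \<Omega> - \<Union>F"
  have Y: "open Y" unfolding Y_def using \<Omega>(1) closed_hyperplanes[OF F(1,2)] by (intro open_Diff)
  have GY: "z \<in> G \<longleftrightarrow> z \<in> Y \<and> cdot a z \<noteq> b" for z
    using H(1) by (auto simp: G_def Y_def F_def Hab)
  obtain p where p: "p \<in> H" "p \<in> \<Omega>" "p \<notin> \<Union>F"
    using hyperplane_point_off_hyperplanes[OF S(2)[OF H(1)] \<Omega>(1) H(2) F(1,3)] by auto
  obtain w :: "complex ^ 'n" where w: "w \<noteq> 0" "cdot a w = 0" using cdot_kernel[OF dim] .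
  have int: "interior \<Omega> = \<Omega>" using \<Omega>(1) by (rule interior_open)
  obtain d where d: "d > 0" "p + d *\<^sub>R w \<in> frontier \<Omega>" "\<And>e. 0 \<le> e \<Longrightarrow> e < d \<Longrightarrow> p + e *\<^sub>R w \<in> \<Omega>"
    using ray_to_frontier[OF \<Omega>(3) _ w(1), of p] p(2) unfolding int by metis
  define x where "x = (\<lambda>e. p + e *\<^sub>R w)"
  define \<xi> where "\<xi> = x d"
  have xH: "cdot a (x e) = b" for e
    using p(1) w(2) by (simp add: x_def Hab cdot_add cdot_scaleR)
  have xi: "\<xi> \<in> closure \<Omega>" "\<xi> \<notin> \<Omega>" using d(2) int by (auto simp: \<xi>_def x_def frontier_def)
  obtain e1 where e1: "0 \<le> e1" "e1 < d" "\<And>e. e1 \<le> e \<Longrightarrow> e < d \<Longrightarrow> x e \<in> Y"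
  proof -
    define Z where "Z = {e. x e \<in> \<Union>F}"
    have "Z = complex_of_real -` {\<zeta>. p + \<zeta> *s w \<in> \<Union>F}" by (auto simp: Z_def x_def scaleR_eq_cscale)
    moreover have "finite (complex_of_real -` {\<zeta>. p + \<zeta> *s w \<in> \<Union>F})"
      by (rule finite_vimageI[OF finite_line_meets_hyperplanes[OF F(1,2) p(3)]]) (auto simp: inj_on_def)
    ultimately have "finite Z" by simp
    define e0 where "e0 = Max (insert 0 {e \<in> Z. e < d})"
    have fin: "finite (insert 0 {e \<in> Z. e < d})" using \<open>finite Z\<close> by simp
    have "e0 < d" unfolding e0_def using fin d(1) by (subst Max_less_iff) auto
    have "0 \<le> e0" unfolding e0_def using fin by simp
    have "x e \<in> Y" if "(e0 + d) / 2 \<le> e" "e < d" for e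
    proof -
      have "e > e0" using that \<open>e0 < d\<close> by (simp add: field_simps)
      have "e \<notin> Z"
      proof
        assume "e \<in> Z"
        then have "e \<le> e0" unfolding e0_def using fin that by (intro Max_ge) auto
        then show False using \<open>e > e0\<close> by simp
      qed
      then show ?thesis using d(3)[of e] that \<open>e > e0\<close> \<open>0 \<le> e0\<close> by (auto simp: Y_def Z_def x_def)
    qed
    then show ?thesis using that[of "(e0 + d) / 2"] \<open>0 \<le> e0\<close> \<open>e0 < d\<close> d(1) by auto
  qed
  obtain h where h: "\<And>z. z \<in> \<Omega> \<Longrightarrow> 0 < h \<bullet> (z - \<xi>)" "pos_pluriharmonic G (\<lambda>z. h \<bullet> (z - \<xi>))"
    using supporting_pluriharmonic[OF \<Omega>(1,2) xi, of G] unfolding G_def by blast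
  define \<kappa> where "\<kappa> = - (h \<bullet> w)"
  have hx: "h \<bullet> (x e - \<xi>) = (d - e) * \<kappa>" for e
    by (simp add: x_def \<xi>_def \<kappa>_def inner_diff_right inner_add_right algebra_simps)
  have \<kappa>: "\<kappa> > 0"
  proof -
    have "x e1 \<in> \<Omega>" using e1(3)[of e1] e1(2) by (simp add: Y_def)
    then have "0 < (d - e1) * \<kappa>" using h(1) hx by metis
    then show ?thesis using e1(2) by (simp add: zero_less_mult_iff)
  qed
  define r where "r = exp (- 2 * \<bar>W\<bar>) / 4"
  have r: "0 < r" "r \<le> 1/4" by (auto simp: r_def)
  define e2 where "e2 = d - (d - e1) * r"
  define g1 where "g1 = (d - e1) * \<kappa>"
  have g1: "g1 > 0" using e1(2) \<kappa> by (simp add: g1_def)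
  have "(d - e1) * r < (d - e1) * 1" using e1(2) r by (intro mult_strict_left_mono) auto
  then have "e1 < e2" unfolding e2_def left_diff_distrib by linarith
  moreover have "e2 < d" using e1(2) r by (simp add: e2_def)
  ultimately have e2: "e1 < e2" "e2 < d" by auto
  have hx1: "h \<bullet> (x e1 - \<xi>) = g1" and hx2: "h \<bullet> (x e2 - \<xi>) = g1 * r"
    by (simp_all add: hx g1_def e2_def)
  have contx: "continuous_on A x" for A unfolding x_def by (intro continuous_intros)
  obtain \<delta> where \<delta>: "\<delta> > 0" "\<And>e. e \<in> {e1..e2} \<Longrightarrow> ball (x e) \<delta> \<subseteq> Y"
  proof -
    have "compact (x ` {e1..e2})" by (intro compact_continuous_image contx) auto
    moreover have "x ` {e1..e2} \<subseteq> Y" using e1(3) e2 by auto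
    ultimately obtain \<delta> where "\<delta> > 0" "(\<Union>y\<in>x ` {e1..e2}. ball y \<delta>) \<subseteq> Y"
      using compact_subset_open_imp_ball_epsilon_subset[OF _ Y] by metis
    then show ?thesis using that[of \<delta>] by blast
  qed
  obtain v1 where v1: "cdot a v1 = 1" using cdot_surj[OF a] .
  then have "v1 \<noteq> 0" by (auto simp: cdot_def)
  \<comment> \<open>Half of \<open>\<delta>\<close> is reserved for discs parallel to \<open>H\<close>, needed for the short sides.\<close>
  define v where "v = (\<delta> / (2 * norm v1)) *\<^sub>R v1"
  have nv: "norm v = \<delta> / 2" using \<delta>(1) \<open>v1 \<noteq> 0\<close> by (simp add: v_def)
  have av: "cdot a v \<noteq> 0" using \<delta>(1) \<open>v1 \<noteq> 0\<close> v1 by (simp add: v_def cdot_scaleR)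
  have vx: "x e + \<zeta> *s v \<in> G" if e: "e \<in> {e1..e2}" and z: "\<zeta> \<noteq> 0" "cmod \<zeta> < 1" for e \<zeta>
  proof -
    have "cmod \<zeta> * (\<delta> / 2) < 1 * \<delta>" using z \<delta>(1) by (intro mult_strict_mono) auto
    then have "x e + \<zeta> *s v \<in> ball (x e) \<delta>" by (simp add: dist_norm norm_cscale nv)
    moreover have "cdot a (x e + \<zeta> *s v) \<noteq> b" using xH[of e] z av by (simp add: cdot_add cdot_cscale)
    ultimately show ?thesis using \<delta>(2)[OF e] GY by blast
  qed
  obtain R where R: "R > 0" "pos_pluriharmonic G (\<lambda>z. ln (R / cmod (cdot a z - b)))"
    by (rule hyperplane_pluriharmonic[OF bG Hab]) (use H(1) in \<open>auto simp: G_def\<close>)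
  have "eventually (\<lambda>t. 2 * \<bar>ln (R / cmod (cdot a v))\<bar> \<le> exp (2 * t) \<and>
      exp (- exp (2 * t)) * \<bar>h \<bullet> v\<bar> \<le> g1 * r) at_top"
  proof (rule eventually_conj)
    have lim: "filterlim (\<lambda>t::real. exp (2 * t)) at_top at_top"
      by (rule filterlim_compose[OF exp_at_top])
         (rule filterlim_tendsto_pos_mult_at_top[OF tendsto_const _ filterlim_ident], simp)
    then show "eventually (\<lambda>t. 2 * \<bar>ln (R / cmod (cdot a v))\<bar> \<le> exp (2 * t)) at_top"
      by (simp add: filterlim_at_top)
    have "((\<lambda>t::real. exp (- exp (2 * t))) \<longlongrightarrow> 0) at_top"
      by (rule filterlim_compose[OF exp_at_bot filterlim_compose[OF filterlim_uminus_at_bot_at_top lim]])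
    then have "((\<lambda>t. exp (- exp (2 * t)) * \<bar>h \<bullet> v\<bar>) \<longlongrightarrow> 0) at_top" by (rule tendsto_mult_left_zero)
    then have "eventually (\<lambda>t. exp (- exp (2 * t)) * \<bar>h \<bullet> v\<bar> < g1 * r) at_top"
      by (rule order_tendstoD) (use g1 r in simp)
    then show "eventually (\<lambda>t. exp (- exp (2 * t)) * \<bar>h \<bullet> v\<bar> \<le> g1 * r) at_top"
      by eventually_elim simp
  qed
  then obtain T where T: "\<And>t. t \<ge> T \<Longrightarrow> 2 * \<bar>ln (R / cmod (cdot a v))\<bar> \<le> exp (2 * t)"
      "\<And>t. t \<ge> T \<Longrightarrow> exp (- exp (2 * t)) * \<bar>h \<bullet> v\<bar> \<le> g1 * r"
    unfolding eventually_at_top_linorder by blast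
  define c where "c = cusp_ray v (x e1)"
  define c' where "c' = cusp_ray v (x e2)"
  have I: "e1 \<in> {e1..e2}" "e2 \<in> {e1..e2}" using e2 by auto
  have mem: "c t \<in> G" "c' t \<in> G" for t
    using vx[OF I(1)] vx[OF I(2)] by (simp_all add: c_def c'_def cusp_ray_def)
  have up: "kobayashi_dist G (c s) (c t) \<le> t - s" "kobayashi_dist G (c' s) (c' t) \<le> t - s" if "s \<le> t" for s t
    unfolding c_def c'_def
    by (rule cusp_ray_dist_le[OF G(1) vx[OF I(1)] that] cusp_ray_dist_le[OF G(1) vx[OF I(2)] that]; assumption)+
  have low: "t - s - 1 \<le> kobayashi_dist G (c s) (c t)" "t - s - 1 \<le> kobayashi_dist G (c' s) (c' t)"
    if "T \<le> s" "s \<le> t" for s t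
    unfolding c_def c'_def
    by (rule cusp_ray_dist_ge[OF G vx[OF I(1)] R xH av T(1)[OF that(1)] that(2)]
             cusp_ray_dist_ge[OF G vx[OF I(2)] R xH av T(1)[OF that(1)] that(2)]; assumption)+
  have hc: "h \<bullet> (cusp_ray v (x e) t - \<xi>) = h \<bullet> (x e - \<xi>) + exp (- exp (2 * t)) * (h \<bullet> v)" for e t
    by (simp add: cusp_ray_def scaleR_eq_cscale[symmetric] inner_diff_right inner_add_right)
  have small: "\<bar>exp (- exp (2 * t)) * (h \<bullet> v)\<bar> \<le> g1 * r" if "T \<le> t" for t
    using T(2)[OF that] by (simp add: abs_mult)
  have wide: "W \<le> kobayashi_dist G (c s) (c' t)" if "T \<le> s" "T \<le> t" for s t
  proof -
    have "g1 * r \<le> g1 * (1/4)" using g1 r by (intro mult_left_mono) auto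
    then have "g1 / 2 \<le> h \<bullet> (c s - \<xi>)" "h \<bullet> (c' t - \<xi>) \<le> 2 * (g1 * r)"
      using small[OF that(1)] small[OF that(2)] g1 unfolding c_def c'_def hc hx1 hx2 by linarith+
    moreover have "0 < h \<bullet> (c' t - \<xi>)" using h(1) mem by (auto simp: G_def)
    ultimately have "ln (g1 / 2) \<le> ln (h \<bullet> (c s - \<xi>))" "ln (h \<bullet> (c' t - \<xi>)) \<le> ln (2 * (g1 * r))"
      using g1 by (auto intro!: ln_mono)
    moreover have "ln (g1 / 2) - ln (2 * (g1 * r)) = 2 * \<bar>W\<bar>"
    proof -
      have "2 * (g1 * r) = (g1 / 2) * exp (- 2 * \<bar>W\<bar>)" by (simp add: r_def)
      then have "ln (2 * (g1 * r)) = ln (g1 / 2) + ln (exp (- 2 * \<bar>W\<bar>))"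
        using g1 by (simp only: ln_mult_pos half_gt_zero exp_gt_zero)
      then show ?thesis by simp
    qed
    ultimately show ?thesis
      using ln_pos_pluriharmonic_le_dist[OF G h(2) mem(1)[of s] mem(2)[of t]] by linarith
  qed
  have short: "kobayashi_dist G (c t) (c' t) \<le> 2 * norm w / \<delta> * (e2 - e1)" for t
  proof -
    define u where "u = of_real (exp (- exp (2 * t))) *s v"
    have nu: "norm u < \<delta> / 2" and au: "cdot a u \<noteq> 0"
      using \<delta>(1) av by (auto simp: u_def norm_cscale nv cdot_cscale)
    have "kobayashi_dist G (x e1 + u) (x e2 + u) \<le> 2 * norm w / \<delta> * (e2 - e1)"
    proof (rule kobayashi_dist_le_smooth[OF G(1), where \<alpha> = "\<lambda>e. x e + u" and D = "\<lambda>_. w"])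
      show "(\<lambda>e. x e + u) ` {e1..e2} \<subseteq> G"
        using vx[of _ "of_real (exp (- exp (2 * t)))"] by (auto simp: u_def)
      show "((\<lambda>e. x e + u) has_vector_derivative w) (at e)" for e
        unfolding x_def by (auto intro!: derivative_eq_intros)
      fix e assume e: "e \<in> {e1..e2}"
      define \<eta> where "\<eta> = \<delta> / (2 * norm w)"
      have \<eta>: "\<eta> > 0" "\<eta> * norm w = \<delta> / 2" using \<delta>(1) w(1) by (auto simp: \<eta>_def)
      have "x e + u + \<zeta> *s (of_real \<eta> *s w) \<in> G" if "cmod \<zeta> < 1" for \<zeta>
      proof -
        have "norm (u + \<zeta> *s (of_real \<eta> *s w)) \<le> norm u + cmod \<zeta> * (\<eta> * norm w)"
          using norm_triangle_ineq[of u "\<zeta> *s (of_real \<eta> *s w)"] \<eta>(1)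
          by (simp add: norm_cscale norm_mult mult.assoc)
        also have "\<dots> \<le> norm u + 1 * (\<delta> / 2)"
          unfolding \<eta>(2) using that \<delta>(1) by (intro add_left_mono mult_right_mono) auto
        also have "\<dots> < \<delta>" using nu by simp
        finally have "x e + u + \<zeta> *s (of_real \<eta> *s w) \<in> ball (x e) \<delta>"
          by (metis add.assoc add_diff_cancel_left' dist_commute dist_norm mem_ball)
        moreover have "cdot a (x e + u + \<zeta> *s (of_real \<eta> *s w)) \<noteq> b"
          using xH[of e] w(2) au by (simp add: cdot_add cdot_cscale)
        ultimately show ?thesis using \<delta>(2)[OF e] GY by blast
      qed
      then have "kobayashi_metric G (x e + u) (of_real (1 / \<eta>) *s (of_real \<eta> *s w)) \<le> cmod (of_real (1 / \<eta>))"
        by (rule kobayashi_metric_le_affine)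
      moreover have "of_real (1 / \<eta>) *s (of_real \<eta> *s w) = w" using \<eta>(1) by (simp add: vec_eq_iff)
      moreover have "cmod (of_real (1 / \<eta>)) = 2 * norm w / \<delta>"
        using \<eta>(1) by (simp add: norm_divide) (simp add: \<eta>_def)
      ultimately show "kobayashi_metric G (x e + u) w \<le> 2 * norm w / \<delta>" by simp
    qed (use e2 in auto)
    then show ?thesis by (simp add: c_def c'_def cusp_ray_def u_def)
  qed
  show ?thesis
    by (intro exI[of _ c] exI[of _ c'] exI[of _ T] exI[of _ "2 * norm w / \<delta> * (e2 - e1)"] allI impI conjI
        mem short wide low up)
qed

theorem corollary1p5:
  fixes \<Omega> :: "(complex ^ 'n) set" and \<S> :: "(complex ^ 'n) set set"
  assumes dim: "CARD('n) \<ge> 2"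
    and domain: "\<Omega> \<noteq> {}" "open \<Omega>" "connected \<Omega>"
    and "bounded \<Omega>" and "convex \<Omega>"
    and "finite \<S>" and "\<S> \<noteq> {}"
    and "\<And>H. H \<in> \<S> \<Longrightarrow> complex_hyperplane H \<and> H \<inter> \<Omega> \<noteq> {}"
  shows "\<not> gromov_hyperbolic (\<Omega> - \<Union>\<S>) (kobayashi_dist (\<Omega> - \<Union>\<S>))"
proof -
  let ?G = "\<Omega> - \<Union>\<S>"
  have S: "H \<in> \<S> \<Longrightarrow> complex_hyperplane H" for H using assms by blast
  obtain H where H: "H \<in> \<S>" "H \<inter> \<Omega> \<noteq> {}" using assms by blast
  have G: "open ?G" "connected ?G"
    using assms closed_hyperplanes[of \<S>] connected_convex_minus_hyperplanes[of \<Omega> \<S>] by auto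
  show ?thesis
  proof (rule not_gromov_hyperbolic_if_wide_strips)
    show "\<exists>A. geodesic_segment ?G (kobayashi_dist ?G) x y A"
      if "x \<in> ?G" "y \<in> ?G" "0 < kobayashi_dist ?G x y" for x y
      by (rule kobayashi_geodesic_exists[OF G that])
         (rule kobayashi_balls_compact[OF \<open>open \<Omega>\<close> \<open>convex \<Omega>\<close> \<open>bounded \<Omega>\<close> \<open>finite \<S>\<close> S that(1)])
    show "\<exists>c c' T U. \<forall>t\<ge>T. c t \<in> ?G \<and> c' t \<in> ?G \<and> kobayashi_dist ?G (c t) (c' t) \<le> U \<and>
      (\<forall>s\<ge>T. W \<le> kobayashi_dist ?G (c s) (c' t) \<and> (s \<le> t \<longrightarrow>
          t - s - 1 \<le> kobayashi_dist ?G (c s) (c t) \<and> kobayashi_dist ?G (c s) (c t) \<le> t - s \<and>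
          t - s - 1 \<le> kobayashi_dist ?G (c' s) (c' t) \<and> kobayashi_dist ?G (c' s) (c' t) \<le> t - s))" for W
      by (rule wide_strips_in_convex_minus_hyperplanes[OF dim \<open>open \<Omega>\<close> \<open>convex \<Omega>\<close> \<open>bounded \<Omega>\<close> \<open>finite \<S>\<close> S H])
  qed (use kobayashi_dist_refl[OF G(1)] kobayashi_dist_commute[OF G] kobayashi_dist_triangle[OF G] in auto)
qed

end
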